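(* Let $(X,\lambda)$ be a descending type weighted polyhedron. For any cohomology classes $[\phi]\in\mathcal H^p_W(X,\lambda)$ and $[\psi]\in\mathcal H^q_W(X,\lambda)$ (coefficients in $\mathbb Z$), the weighted cup product satisfies $$[\phi]\Cup[\psi]=(-1)^{pq}\,[\psi]\Cup[\phi].$$
   Context: A descending weight on a simplicial complex $K$ is a function $\mu$ assigning a positive integer to each simplex with $\mu(\sigma)\mid\mu(\sigma')$ whenever $\sigma'$ is a face of $\sigma$. It is divisible if the vertices of every simplex can be ordered $v_0,\dots,v_k$ with $\mu(v_0)\mid\cdots\mid\mu(v_k)$ and the weight of that simplex is $\mu(v_0)$. On the geometric realization $|K|\subseteq\mathbb R^N$ put $\lambda_\mu(x)=\mu(\mathrm{Car}_K(x))$, where $\mathrm{Car}_K(x)$ is the unique simplex containing $x$ in the relative interior of its realization. A descending type weighted polyhedron is a pair $(X,\lambda)$, $X$ a topological space, $\lambda:X\to\mathbb Z_+$, for which there is a homeomorphism $X\to|K|$ carrying $\lambda$ to $\lambda_\mu$ for some descending weight $\mu$ on some simplicial complex $K$. A weighted singular $n$-simplex of $(X,\lambda)$ is a continuous map $\theta:|\Delta^n|\to X$ together with a divisible descending weight $\xi$ on the standard $n$-simplex $\Delta^n=[v_0,\dots,v_n]$ such that $\lambda_\xi(x)\mid\lambda(\theta(x))$ for all $x$; it is written $\theta:(|\Delta^n|,\lambda_\xi)\to(X,\lambda)$. Restriction to a face $\sigma$ (with weight $\xi|_\sigma$) gives a weighted singular simplex $\theta|_\sigma$. $\mathcal W_n(X,\lambda)$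 is the free abelian group on weighted singular $n$-simplices, with $\partial^\lambda\theta=\sum_{j=0}^n(-1)^j\frac{\xi(\partial_j\Delta^n)}{\xi(\Delta^n)}\,\theta|_{\partial_j\Delta^n}$, where $\partial_j\Delta^n=[v_0,\dots,\widehat{v_j},\dots,v_n]$ is identified with $\Delta^{n-1}$. The weighted singular cochain complex is $\mathcal W^*(X,\lambda)=\mathrm{Hom}(\mathcal W_*(X,\lambda),\mathbb Z)$ with $\delta^\lambda\phi=\phi\circ\partial^\lambda$, and $\mathcal H^*_W(X,\lambda)$ is its cohomology. The weighted cup product of $\phi\in\mathcal W^p(X,\lambda)$ and $\psi\in\mathcal W^q(X,\lambda)$ is the cochain $\phi\Cup\psi\in\mathcal W^{p+q}(X,\lambda)$ with $$(\phi\Cup\psi)(\theta)=\frac{\xi([v_0,\dots,v_p])\,\xi([v_p,\dots,v_{p+q}])}{\xi([v_0,\dots,v_{p+q}])}\,\phi(\theta|_{[v_0,\dots,v_p]})\cdot\psi(\theta|_{[v_p,\dots,v_{p+q}]})$$ for $\theta:(|\Delta^{p+q}|,\lambda_\xi)\to(X,\lambda)$. It satisfies $\delta^\lambda(\phi\Cup\psi)=\delta^\lambda\phi\Cup\psi+(-1)^p\phi\Cup\delta^\lambda\psi$, hence induces $\Cup:\mathcal H^p_W(X,\lambda)\times\mathcal H^q_W(X,\lambda)\to\mathcal H^{p+q}_W(X,\lambda)$. *)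

theory Defs
  imports "HOL-Analysis.Analysis" "HOL-Homology.Homology"
begin

text \<open>
  Simplices are represented by their finite nonempty vertex sets, both in a geometric complex and in
  the standard simplex. Weights take values in the positive integers, rendered as \<^typ>\<open>nat\<close> with a
  positivity condition.
\<close>

definition descending_weight :: "'v set set \<Rightarrow> ('v set \<Rightarrow> nat) \<Rightarrow> bool" where
  "descending_weight K \<mu> \<longleftrightarrow>
     (\<forall>\<sigma>\<in>K. 0 < \<mu> \<sigma>) \<and> (\<forall>\<sigma>\<in>K. \<forall>\<tau>\<in>K. \<tau> \<subseteq> \<sigma> \<longrightarrow> \<mu> \<sigma> dvd \<mu> \<tau>)"

definition divisible_weight :: "'v set set \<Rightarrow> ('v set \<Rightarrow> nat) \<Rightarrow> bool" where
  "divisible_weight K \<mu> \<longleftrightarrow>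
     (\<forall>\<sigma>\<in>K. \<exists>vs. vs \<noteq> [] \<and> distinct vs \<and> set vs = \<sigma> \<and>
        sorted_wrt (\<lambda>v w. \<mu> {v} dvd \<mu> {w}) vs \<and> \<mu> \<sigma> = \<mu> {hd vs})"


section \<open>Weighted polyhedra\<close>

definition geometric_complex :: "'b::euclidean_space set set \<Rightarrow> bool" where
  "geometric_complex K \<longleftrightarrow>
     (\<forall>\<sigma>\<in>K. finite \<sigma> \<and> \<sigma> \<noteq> {} \<and> \<not> affine_dependent \<sigma>) \<and>
     (\<forall>\<sigma>\<in>K. \<forall>\<tau>. \<tau> \<noteq> {} \<and> \<tau> \<subseteq> \<sigma> \<longrightarrow> \<tau> \<in> K) \<and>
     (\<forall>\<sigma>\<in>K. \<forall>\<tau>\<in>K. (convex hull \<sigma> \<inter> convex hull \<tau>) face_of (convex hull \<sigma>))"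

definition realization :: "'b::euclidean_space set set \<Rightarrow> 'b set" where
  "realization K = (\<Union>\<sigma>\<in>K. convex hull \<sigma>)"

text \<open>
  A complex is not required to be finite, so the realization carries the topology that is coherent
  with its simplices; for finite complexes this is the subspace topology, see
  \<open>realization_topology_finite\<close> below.
\<close>

definition realization_topology :: "'b::euclidean_space set set \<Rightarrow> 'b topology" where
  "realization_topology K =
     topology (\<lambda>U. U \<subseteq> realization K \<and>
       (\<forall>\<sigma>\<in>K. openin (top_of_set (convex hull \<sigma>)) (U \<inter> convex hull \<sigma>)))"

lemma openin_realization_topology:
  "openin (realization_topology K) U \<longleftrightarrow>
     U \<subseteq> realization K \<and> (\<forall>\<sigma>\<in>K. openin (top_of_set (convex hull \<sigma>)) (U \<inter> convex hull \<sigma>))"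
proof -
  have "istopology (\<lambda>U. U \<subseteq> realization K \<and>
       (\<forall>\<sigma>\<in>K. openin (top_of_set (convex hull \<sigma>)) (U \<inter> convex hull \<sigma>)))" (is "istopology ?P")
    unfolding istopology_def
  proof (rule conjI; intro allI impI)
    fix S T assume ST: "?P S" "?P T"
    have "openin (top_of_set (convex hull \<sigma>)) (S \<inter> T \<inter> convex hull \<sigma>)" if "\<sigma> \<in> K" for \<sigma>
    proof -
      have "S \<inter> T \<inter> convex hull \<sigma> = (S \<inter> convex hull \<sigma>) \<inter> (T \<inter> convex hull \<sigma>)"
        by blast
      then show ?thesis
        using ST that openin_Int by metis
    qed
    with ST show "?P (S \<inter> T)"
      by blast
  next
    fix F assume F: "\<forall>S\<in>F. ?P S"
    have "\<Union>F \<inter> convex hull \<sigma> = (\<Union>S\<in>F. S \<inter> convex hull \<sigma>)" for \<sigma>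
      by blast
    moreover have "openin (top_of_set (convex hull \<sigma>)) (\<Union>S\<in>F. S \<inter> convex hull \<sigma>)"
      if "\<sigma> \<in> K" for \<sigma>
      using F that by (intro openin_Union) auto
    ultimately show "?P (\<Union>F)"
      using F by auto
  qed
  then show ?thesis
    by (simp add: realization_topology_def topology_inverse')
qed

lemma topspace_realization_topology: "topspace (realization_topology K) = realization K"
proof
  show "topspace (realization_topology K) \<subseteq> realization K"
    using openin_realization_topology openin_topspace by blast
  have "realization K \<inter> convex hull \<sigma> = convex hull \<sigma>" if "\<sigma> \<in> K" for \<sigma>
    using that by (auto simp: realization_def)
  then have "openin (realization_topology K) (realization K)"
    by (simp add: openin_realization_topology)
  then show "realization K \<subseteq> topspace (realization_topology K)"
    by (rule openin_subset)
qed

lemma realization_topology_finite: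
  assumes "finite K" "geometric_complex K"
  shows "realization_topology K = top_of_set (realization K)"
proof (rule topology_eq[THEN iffD2], intro allI iffI)
  fix U assume U: "openin (realization_topology K) U"
  have cpt: "compact (convex hull \<sigma>)" if "\<sigma> \<in> K" for \<sigma>
    using assms that by (auto simp: geometric_complex_def finite_imp_compact_convex_hull)
  have "closed (convex hull \<sigma> - U)" if "\<sigma> \<in> K" for \<sigma>
  proof -
    have "openin (top_of_set (convex hull \<sigma>)) (U \<inter> convex hull \<sigma>)"
      using U that by (simp add: openin_realization_topology)
    then have "closedin (top_of_set (convex hull \<sigma>)) (convex hull \<sigma> - U \<inter> convex hull \<sigma>)"
      by (simp add: closedin_def Int_absorb1 double_diff)
    then have "closed (convex hull \<sigma> - U \<inter> convex hull \<sigma>)"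
      using closedin_closed_trans cpt[OF that] compact_imp_closed by blast
    moreover have "convex hull \<sigma> - U \<inter> convex hull \<sigma> = convex hull \<sigma> - U" by blast
    ultimately show ?thesis by simp
  qed
  then have "closed (\<Union>\<sigma>\<in>K. convex hull \<sigma> - U)"
    using assms by blast
  moreover have "U = realization K \<inter> - (\<Union>\<sigma>\<in>K. convex hull \<sigma> - U)"
    using U by (auto simp: openin_realization_topology realization_def)
  ultimately show "openin (top_of_set (realization K)) U"
    by (metis open_Compl openin_open)
next
  fix U assume "openin (top_of_set (realization K)) U"
  then obtain T where "open T" "U = realization K \<inter> T"
    by (auto simp: openin_open)
  moreover have "realization K \<inter> T \<inter> convex hull \<sigma> = convex hull \<sigma> \<inter> T" if "\<sigma> \<in> K" for \<sigma>
    using that by (auto simp: realization_def)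
  ultimately show "openin (realization_topology K) U"
    by (auto simp: openin_realization_topology openin_open)
qed

definition Car :: "'b::euclidean_space set set \<Rightarrow> 'b \<Rightarrow> 'b set" where
  "Car K x = (THE \<sigma>. \<sigma> \<in> K \<and> x \<in> rel_interior (convex hull \<sigma>))"

text \<open>The type argument \<open>'b\<close> provides the Euclidean space in which the complex lives.\<close>

definition descending_weighted_polyhedron ::
  "'b::euclidean_space itself \<Rightarrow> 'a topology \<Rightarrow> ('a \<Rightarrow> nat) \<Rightarrow> bool" where
  "descending_weighted_polyhedron TYPE('b) X lam \<longleftrightarrow>
     (\<exists>(K :: 'b set set) \<mu> h.
        geometric_complex K \<and> descending_weight K \<mu> \<and>
        homeomorphic_map X (realization_topology K) h \<and>
        (\<forall>x\<in>topspace X. lam x = \<mu> (Car K (h x))))"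


section \<open>Weighted singular chains\<close>

definition std_complex :: "nat \<Rightarrow> nat set set" where
  "std_complex n = {\<sigma>. \<sigma> \<noteq> {} \<and> \<sigma> \<subseteq> {..n}}"

text \<open>
  The face of the standard simplex with vertices \<open>\<sigma>\<close> has as relative interior the points whose
  nonzero barycentric coordinates are exactly those in \<open>\<sigma>\<close>.
\<close>

definition std_carrier :: "(nat \<Rightarrow> real) \<Rightarrow> nat set" where
  "std_carrier x = {i. x i \<noteq> 0}"

type_synonym 'a wsimplex = "((nat \<Rightarrow> real) \<Rightarrow> 'a) \<times> (nat set \<Rightarrow> nat)"

text \<open>
  Both components are extensional, so that weighted singular simplices are equal iff their maps
  agree on the standard simplex and their weights agree on its faces.
\<close>

definition wsimplex :: "nat \<Rightarrow> 'a topology \<Rightarrow> ('a \<Rightarrow> nat) \<Rightarrow> 'a wsimplex set" where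
  "wsimplex n X lam = {(\<theta>, \<xi>).
     singular_simplex n X \<theta> \<and>
     \<xi> \<in> extensional (std_complex n) \<and>
     descending_weight (std_complex n) \<xi> \<and> divisible_weight (std_complex n) \<xi> \<and>
     (\<forall>x\<in>standard_simplex n. \<xi> (std_carrier x) dvd lam (\<theta> x))}"

text \<open>
  Restriction to the \<open>k\<close>-dimensional face with vertices \<open>v\<^bsub>\<iota> 0\<^esub>, \<dots>, v\<^bsub>\<iota> k\<^esub>\<close>, where \<open>\<iota>\<close> is
  strictly increasing; the face is identified with the standard \<open>k\<close>-simplex through the affine map
  that sends vertex \<open>i\<close> to vertex \<open>\<iota> i\<close>.
\<close>

definition wface :: "nat \<Rightarrow> (nat \<Rightarrow> nat) \<Rightarrow> 'a wsimplex \<Rightarrow> 'a wsimplex" where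
  "wface k \<iota> s =
     (simplex_map k (fst s) (oriented_simplex k (\<lambda>i j. if j = \<iota> i then 1 else 0)),
      restrict (\<lambda>\<sigma>. snd s (\<iota> ` \<sigma>)) (std_complex k))"

definition wchain_group :: "nat \<Rightarrow> 'a topology \<Rightarrow> ('a \<Rightarrow> nat) \<Rightarrow> ('a wsimplex \<Rightarrow>\<^sub>0 int) monoid" where
  "wchain_group n X lam = free_Abelian_group (wsimplex n X lam)"

text \<open>
  The divisions in this and the cup product below are exact, because the weight of a simplex
  divides the weight of each of its faces.
\<close>

definition wboundary :: "nat \<Rightarrow> ('a wsimplex \<Rightarrow>\<^sub>0 int) \<Rightarrow> ('a wsimplex \<Rightarrow>\<^sub>0 int)" where
  "wboundary n c =
     (if n = 0 then 0 else
      frag_extend (\<lambda>s. \<Sum>j\<le>n.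
        frag_cmul ((-1) ^ j * int (snd s ({..n} - {j}) div snd s {..n}))
          (frag_of (wface (n - 1) (\<lambda>i. if i < j then i else Suc i) s))) c)"


section \<open>Weighted singular cohomology\<close>

text \<open>Cochains are extensional on the chain group, so that their equality is equality of functions.\<close>

definition wcochain_group ::
  "nat \<Rightarrow> 'a topology \<Rightarrow> ('a \<Rightarrow> nat) \<Rightarrow> (('a wsimplex \<Rightarrow>\<^sub>0 int) \<Rightarrow> int) monoid" where
  "wcochain_group n X lam =
     \<lparr>carrier = hom (wchain_group n X lam) integer_group \<inter> extensional (carrier (wchain_group n X lam)),
      monoid.mult = (\<lambda>\<phi> \<psi>. restrict (\<lambda>c. \<phi> c + \<psi> c) (carrier (wchain_group n X lam))),
      one = restrict (\<lambda>c. 0) (carrier (wchain_group n X lam))\<rparr>"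

definition wcoboundary ::
  "nat \<Rightarrow> 'a topology \<Rightarrow> ('a \<Rightarrow> nat) \<Rightarrow> (('a wsimplex \<Rightarrow>\<^sub>0 int) \<Rightarrow> int) \<Rightarrow>
     ('a wsimplex \<Rightarrow>\<^sub>0 int) \<Rightarrow> int" where
  "wcoboundary n X lam \<phi> = restrict (\<phi> \<circ> wboundary (Suc n)) (carrier (wchain_group (Suc n) X lam))"

definition wcocycles ::
  "nat \<Rightarrow> 'a topology \<Rightarrow> ('a \<Rightarrow> nat) \<Rightarrow> (('a wsimplex \<Rightarrow>\<^sub>0 int) \<Rightarrow> int) set" where
  "wcocycles n X lam =
     kernel (wcochain_group n X lam) (wcochain_group (Suc n) X lam) (wcoboundary n X lam)"

definition wcoboundaries ::
  "nat \<Rightarrow> 'a topology \<Rightarrow> ('a \<Rightarrow> nat) \<Rightarrow> (('a wsimplex \<Rightarrow>\<^sub>0 int) \<Rightarrow> int) set" where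
  "wcoboundaries n X lam =
     (case n of
        0 \<Rightarrow> {\<one>\<^bsub>wcochain_group 0 X lam\<^esub>}
      | Suc m \<Rightarrow> wcoboundary m X lam ` carrier (wcochain_group m X lam))"

definition wcocycle_group ::
  "nat \<Rightarrow> 'a topology \<Rightarrow> ('a \<Rightarrow> nat) \<Rightarrow> (('a wsimplex \<Rightarrow>\<^sub>0 int) \<Rightarrow> int) monoid" where
  "wcocycle_group n X lam = (wcochain_group n X lam)\<lparr>carrier := wcocycles n X lam\<rparr>"

definition wcohomology_group ::
  "nat \<Rightarrow> 'a topology \<Rightarrow> ('a \<Rightarrow> nat) \<Rightarrow> (('a wsimplex \<Rightarrow>\<^sub>0 int) \<Rightarrow> int) set monoid" where
  "wcohomology_group n X lam = wcocycle_group n X lam Mod wcoboundaries n X lam"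

definition wclass ::
  "nat \<Rightarrow> 'a topology \<Rightarrow> ('a \<Rightarrow> nat) \<Rightarrow> (('a wsimplex \<Rightarrow>\<^sub>0 int) \<Rightarrow> int) \<Rightarrow>
     (('a wsimplex \<Rightarrow>\<^sub>0 int) \<Rightarrow> int) set" where
  "wclass n X lam \<phi> = wcoboundaries n X lam #>\<^bsub>wcocycle_group n X lam\<^esub> \<phi>"


section \<open>The weighted cup product\<close>

definition wcup ::
  "nat \<Rightarrow> nat \<Rightarrow> 'a topology \<Rightarrow> ('a \<Rightarrow> nat) \<Rightarrow> (('a wsimplex \<Rightarrow>\<^sub>0 int) \<Rightarrow> int) \<Rightarrow>
     (('a wsimplex \<Rightarrow>\<^sub>0 int) \<Rightarrow> int) \<Rightarrow> ('a wsimplex \<Rightarrow>\<^sub>0 int) \<Rightarrow> int" where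
  "wcup p q X lam \<phi> \<psi> =
     restrict
       (\<lambda>c. \<Sum>s\<in>Poly_Mapping.keys c. Poly_Mapping.lookup c s *
          (int (snd s {..p} * snd s {p..p + q} div snd s {..p + q}) *
           \<phi> (frag_of (wface p (\<lambda>i. i) s)) * \<psi> (frag_of (wface q (\<lambda>i. p + i) s))))
       (carrier (wchain_group (p + q) X lam))"

text \<open>
  The product of two cohomology classes is the union of the classes of the products of all
  representatives. Since the cup product descends to cohomology, these classes all coincide and the
  union is a single class.
\<close>

definition wcup_class ::
  "nat \<Rightarrow> nat \<Rightarrow> 'a topology \<Rightarrow> ('a \<Rightarrow> nat) \<Rightarrow> (('a wsimplex \<Rightarrow>\<^sub>0 int) \<Rightarrow> int) set \<Rightarrow>
     (('a wsimplex \<Rightarrow>\<^sub>0 int) \<Rightarrow> int) set \<Rightarrow> (('a wsimplex \<Rightarrow>\<^sub>0 int) \<Rightarrow> int) set" where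
  "wcup_class p q X lam A B = (\<Union>\<phi>\<in>A. \<Union>\<psi>\<in>B. wclass (p + q) X lam (wcup p q X lam \<phi> \<psi>))"

end

theory Submission
  imports Defs
begin

text \<open>
  The classical proof of graded commutativity carries over. Reversing the vertices of each simplex, with the
  sign \<open>\<epsilon>\<^sub>n = (-1)\<^bsup>n(n+1)/2\<^esup>\<close>, swaps the two factors of a cup product and contributes the sign
  \<open>\<epsilon>\<^sub>p\<^sub>+\<^sub>q \<epsilon>\<^sub>p \<epsilon>\<^sub>q = (-1)\<^bsup>pq\<^esup>\<close>; and it is chain homotopic to the identity by the prism operator. All
  simplices occurring in the prism operator are pullbacks of the given weighted simplex along (possibly degenerate)
  simplicial maps onto the standard simplex, so that they are again divisibly weighted and their top weight is
  unchanged.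
\<close>


section \<open>Pullback along vertex maps\<close>

text \<open>The obstacle is integrality: the statement has integer coefficients, so weights may not
  be inverted, and every operator and primitive must take integer values. Both the reversal and the
  projections of the prism simplices are onto the vertices of the given simplex. As they preserve
  the top weight, the two operators need no weight coefficients, and their classical formulas are
  already integral. For the projections this forces degenerate simplices: they identify vertices,
  and a theory of injective faces alone would not contain them. Hence restriction to faces, reversal
  and the prism are all treated as one operation, pullback along an arbitrary vertex map, and every
  simplicial identity becomes an equation between functions on an initial segment of the naturals.
  Cochains are determined by their values on generators, so the argument runs on plain functions of
  simplices; homomorphisms, cosets and quotient groups enter only at the end.\<close>

abbreviation vertex_map :: "nat \<Rightarrow> (nat \<Rightarrow> nat) \<Rightarrow> (nat \<Rightarrow> real) \<Rightarrow> nat \<Rightarrow> real" where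
  "vertex_map k f \<equiv> oriented_simplex k (\<lambda>i j. if j = f i then 1 else 0)"

lemma vertex_map_apply:
  assumes "x \<in> standard_simplex k"
  shows "vertex_map k f x j = (\<Sum>i | i \<le> k \<and> f i = j. x i)"
proof -
  have "vertex_map k f x j = (\<Sum>i\<le>k. if f i = j then x i else 0)"
    using assms by (auto simp: oriented_simplex_def intro!: sum.cong)
  also have "\<dots> = (\<Sum>i | i \<in> {..k} \<and> f i = j. x i)"
    by (subst sum.inter_filter) auto
  finally show ?thesis by simp
qed

lemma vertex_map_in_standard_simplex:
  assumes x: "x \<in> standard_simplex k" and f: "f ` {..k} \<subseteq> {..n}"
  shows "vertex_map k f x \<in> standard_simplex n"
proof -
  have nonneg: "0 \<le> x i" for i
    using x by (auto simp: standard_simplex_def)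
  have tot: "(\<Sum>i\<le>k. x i) = 1"
    using x by (auto simp: standard_simplex_def)
  have "(\<Sum>i | i \<le> k \<and> f i = j. x i) \<le> (\<Sum>i\<le>k. x i)" for j
    by (intro sum_mono2) (auto simp: nonneg)
  moreover have "(\<Sum>i | i \<le> k \<and> f i = j. x i) = 0" if "j > n" for j
    using f that by (intro sum.neutral) force
  moreover have "(\<Sum>j\<le>n. \<Sum>i | i \<le> k \<and> f i = j. x i) = (\<Sum>i\<le>k. x i)"
    using sum.group[of "{..k}" "{..n}" f x] f by simp
  ultimately show ?thesis
    using tot by (auto simp: standard_simplex_def vertex_map_apply[OF x] nonneg sum_nonneg)
qed

lemma std_carrier_in_std_complex:
  assumes "x \<in> standard_simplex k"
  shows "std_carrier x \<in> std_complex k"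
proof -
  have "std_carrier x \<noteq> {}"
  proof
    assume "std_carrier x = {}"
    then have "(\<Sum>i\<le>k. x i) = 0"
      by (auto simp: std_carrier_def)
    with assms show False
      by (simp add: standard_simplex_def)
  qed
  moreover have "i \<le> k" if "x i \<noteq> 0" for i
    using assms that by (force simp: standard_simplex_def not_le[symmetric])
  ultimately show ?thesis
    by (auto simp: std_complex_def std_carrier_def)
qed

text \<open>Barycentric coordinates are nonnegative, so nothing cancels when they are added over a
  fibre of \<open>f\<close>. This is why the condition relating weights to \<open>lam\<close>
  survives maps that identify vertices.\<close>

lemma std_carrier_vertex_map:
  assumes x: "x \<in> standard_simplex k"
  shows "std_carrier (vertex_map k f x) = f ` std_carrier x"
proof -
  have nonneg: "0 \<le> x i" and le: "x i \<noteq> 0 \<Longrightarrow> i \<le> k" for i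
    using x by (force simp: standard_simplex_def not_le[symmetric])+
  have "(\<Sum>i | i \<le> k \<and> f i = j. x i) \<noteq> 0 \<longleftrightarrow> (\<exists>i. x i \<noteq> 0 \<and> f i = j)" for j
    using le by (subst sum_nonneg_eq_0_iff) (auto simp: nonneg)
  then show ?thesis
    by (auto simp: std_carrier_def vertex_map_apply[OF x])
qed

lemma vertex_map_vertex_map:
  assumes x: "x \<in> standard_simplex k" and g: "g ` {..k} \<subseteq> {..m}"
  shows "vertex_map m f (vertex_map k g x) = vertex_map k (f \<circ> g) x"
proof
  fix j
  have "vertex_map m f (vertex_map k g x) j
      = (\<Sum>a | a \<le> m \<and> f a = j. \<Sum>i | i \<in> {i. i \<le> k \<and> f (g i) = j} \<and> g i = a. x i)"
    by (subst vertex_map_apply[OF vertex_map_in_standard_simplex[OF x g]])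
      (auto simp: vertex_map_apply[OF x] intro!: sum.cong)
  also have "\<dots> = (\<Sum>i | i \<le> k \<and> f (g i) = j. x i)"
    using g by (intro sum.group) auto
  finally show "vertex_map m f (vertex_map k g x) j = vertex_map k (f \<circ> g) x j"
    by (simp add: vertex_map_apply[OF x])
qed

lemma image_std_complex:
  assumes "\<sigma> \<in> std_complex k" "f ` {..k} \<subseteq> {..n}"
  shows "f ` \<sigma> \<in> std_complex n"
  using assms by (auto simp: std_complex_def)

lemma atMost_std_complex: "{..n} \<in> std_complex n"
  by (auto simp: std_complex_def)

text \<open>Together with \<open>wface_wface\<close> this reduces simplicial identities to
  arithmetic on indices up to \<open>k\<close>; values beyond, such as those of truncated
  subtraction, do not matter.\<close>

lemma wface_cong:
  assumes "\<And>i. i \<le> k \<Longrightarrow> f i = g i"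
  shows "wface k f s = wface k g s"
proof -
  have "vertex_map k f = vertex_map k g"
    by (simp add: oriented_simplex_eq assms)
  moreover have "f ` \<sigma> = g ` \<sigma>" if "\<sigma> \<in> std_complex k" for \<sigma>
    using that assms by (intro image_cong) (auto simp: std_complex_def)
  then have "restrict (\<lambda>\<sigma>. snd s (f ` \<sigma>)) (std_complex k) = restrict (\<lambda>\<sigma>. snd s (g ` \<sigma>)) (std_complex k)"
    by (intro restrict_ext) auto
  ultimately show ?thesis
    by (simp add: wface_def)
qed

lemma snd_wface: "\<sigma> \<in> std_complex k \<Longrightarrow> snd (wface k f s) \<sigma> = snd s (f ` \<sigma>)"
  by (simp add: wface_def)

lemma wface_wface:
  assumes g: "g ` {..k} \<subseteq> {..m}"
  shows "wface k g (wface m f s) = wface k (f \<circ> g) s"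
proof -
  have "simplex_map k (simplex_map m (fst s) (vertex_map m f)) (vertex_map k g)
      = simplex_map k (fst s) (vertex_map k (f \<circ> g))"
    unfolding simplex_map_def
  proof (rule restrict_ext)
    fix x assume x: "x \<in> standard_simplex k"
    have "vertex_map m f (vertex_map k g x) = vertex_map k (f \<circ> g) x"
      by (rule vertex_map_vertex_map[OF x g])
    then show "(restrict (fst s \<circ> vertex_map m f) (standard_simplex m) \<circ> vertex_map k g) x
        = (fst s \<circ> vertex_map k (f \<circ> g)) x"
      using vertex_map_in_standard_simplex[OF x g] by simp
  qed
  moreover have "restrict (\<lambda>\<sigma>. snd (wface m f s) (g ` \<sigma>)) (std_complex k)
      = restrict (\<lambda>\<sigma>. snd s ((f \<circ> g) ` \<sigma>)) (std_complex k)"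
    by (rule restrict_ext) (simp add: snd_wface image_std_complex[OF _ g] image_comp)
  ultimately show ?thesis
    unfolding wface_def by simp
qed

text \<open>A pullback is always restricted to the simplex and its faces, so equality with
  \<open>s\<close> rests on the extensionality of both components of a weighted simplex.\<close>

lemma wface_id:
  assumes "s \<in> wsimplex n X lam"
  shows "wface n (\<lambda>i. i) s = s"
proof -
  obtain \<theta> \<xi> where s: "s = (\<theta>, \<xi>)" and \<theta>: "\<theta> \<in> extensional (standard_simplex n)"
    and \<xi>: "\<xi> \<in> extensional (std_complex n)"
    using assms by (cases s) (auto simp: wsimplex_def singular_simplex_def)
  have "vertex_map n (\<lambda>i. i) x = x" if x: "x \<in> standard_simplex n" for x
  proof
    fix j
    have "{i. i \<le> n \<and> i = j} = (if j \<le> n then {j} else {})" by auto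
    moreover have "x j = 0" if "j > n"
      using x that by (auto simp: standard_simplex_def)
    ultimately show "vertex_map n (\<lambda>i. i) x j = x j"
      by (simp add: vertex_map_apply[OF x])
  qed
  then have "simplex_map n \<theta> (vertex_map n (\<lambda>i. i)) = \<theta>"
    using \<theta> by (intro extensionalityI[where A = "standard_simplex n"]) (auto simp: simplex_map_def)
  then show ?thesis
    using \<xi> by (simp add: s wface_def extensional_restrict)
qed

text \<open>The vertices of a degenerate simplex are sorted by the position of their images.\<close>

lemma divisible_weight_pullback:
  assumes \<xi>: "divisible_weight (std_complex n) \<xi>" and f: "f ` {..k} \<subseteq> {..n}"
  shows "divisible_weight (std_complex k) (\<lambda>\<sigma>. \<xi> (f ` \<sigma>))"
  unfolding divisible_weight_def
proof
  fix \<sigma> assume \<sigma>: "\<sigma> \<in> std_complex k"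
  then have fin: "finite \<sigma>" and ne: "\<sigma> \<noteq> {}"
    using finite_subset[of \<sigma> "{..k}"] by (auto simp: std_complex_def)
  obtain vs where vs: "vs \<noteq> []" "set vs = f ` \<sigma>" "sorted_wrt (\<lambda>v w. \<xi> {v} dvd \<xi> {w}) vs"
    "\<xi> (f ` \<sigma>) = \<xi> {hd vs}"
    using bspec[OF \<xi>[unfolded divisible_weight_def] image_std_complex[OF \<sigma> f]] by blast
  have "\<exists>pos. \<forall>v\<in>f ` \<sigma>. pos v < length vs \<and> vs ! pos v = v"
    unfolding vs(2)[symmetric] by (intro bchoice) (auto simp: in_set_conv_nth)
  then obtain pos where pos: "\<And>v. v \<in> f ` \<sigma> \<Longrightarrow> pos v < length vs \<and> vs ! pos v = v"
    by blast
  define ws where "ws = sort_key (pos \<circ> f) (sorted_list_of_set \<sigma>)"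
  have set_ws: "set ws = \<sigma>"
    using fin by (simp add: ws_def)
  have "sorted_wrt (\<lambda>v w. pos (f v) \<le> pos (f w)) ws"
    using sorted_sort_key[of "pos \<circ> f" "sorted_list_of_set \<sigma>"]
    by (simp add: ws_def sorted_map)
  then have sorted_ws: "sorted_wrt (\<lambda>v w. \<xi> {f v} dvd \<xi> {f w}) ws"
  proof (rule sorted_wrt_mono_rel[rotated])
    fix v w assume "v \<in> set ws" "w \<in> set ws" and le: "pos (f v) \<le> pos (f w)"
    then have "f v \<in> f ` \<sigma>" "f w \<in> f ` \<sigma>"
      by (auto simp: set_ws)
    note pos_vw = pos[OF this(1)] pos[OF this(2)]
    show "\<xi> {f v} dvd \<xi> {f w}"
    \<comment> \<open>Vertices tied in the sort have the same image, hence equal weights; strictly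
      ordered positions inherit divisibility from \<open>vs\<close>.\<close>
    proof (cases "pos (f v) = pos (f w)")
      case True
      then have "f v = f w"
        using pos_vw by metis
      then show ?thesis by simp
    next
      case False
      then have "\<xi> {vs ! pos (f v)} dvd \<xi> {vs ! pos (f w)}"
        using le pos_vw by (intro sorted_wrt_nth_less[OF vs(3)]) auto
      then show ?thesis
        using pos_vw by (simp del: dvd_refl)
    qed
  qed
  have ws: "ws \<noteq> []"
    using set_ws ne by auto
  \<comment> \<open>Both heads have the least weight, in the divisibility order, over the image
    face, so antisymmetry identifies their weights without tracking positions.\<close>
  have min_ws: "\<xi> {f (hd ws)} dvd \<xi> {f w}" if "w \<in> \<sigma>" for w
    using sorted_ws that unfolding set_ws[symmetric] by (cases ws) auto
  have min_vs: "\<xi> {hd vs} dvd \<xi> {v}" if "v \<in> f ` \<sigma>" for v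
    using vs(3) that unfolding vs(2)[symmetric] by (cases vs) auto
  have "hd vs \<in> f ` \<sigma>" "hd ws \<in> \<sigma>"
    using hd_in_set[OF vs(1)] hd_in_set[OF ws] by (simp_all add: vs(2) set_ws)
  then have "\<xi> {hd vs} = \<xi> {f (hd ws)}"
    by (intro dvd_antisym min_vs) (auto intro: min_ws)
  then show "\<exists>us. us \<noteq> [] \<and> distinct us \<and> set us = \<sigma> \<and>
      sorted_wrt (\<lambda>v w. \<xi> (f ` {v}) dvd \<xi> (f ` {w})) us \<and> \<xi> (f ` \<sigma>) = \<xi> (f ` {hd us})"
    using ws set_ws sorted_ws vs(4) by (intro exI[of _ ws]) (auto simp: ws_def)
qed

text \<open>As \<open>f\<close> may identify vertices, this covers proper faces, the reversal and
  the degenerate prism simplices at once.\<close>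

lemma wface_in_wsimplex:
  assumes s: "s \<in> wsimplex n X lam" and f: "f ` {..k} \<subseteq> {..n}"
  shows "wface k f s \<in> wsimplex k X lam"
proof -
  obtain \<theta> \<xi> where s_eq: "s = (\<theta>, \<xi>)" by (cases s)
  have \<theta>: "singular_simplex n X \<theta>" and desc: "descending_weight (std_complex n) \<xi>"
    and div: "divisible_weight (std_complex n) \<xi>"
    and lam: "\<And>x. x \<in> standard_simplex n \<Longrightarrow> \<xi> (std_carrier x) dvd lam (\<theta> x)"
    using s by (auto simp: s_eq wsimplex_def)
  let ?\<xi>' = "restrict (\<lambda>\<sigma>. \<xi> (f ` \<sigma>)) (std_complex k)"
  have "simplicial_simplex k (standard_simplex n) (vertex_map k f)"
    using vertex_map_in_standard_simplex[OF _ f] by (auto simp: simplicial_simplex)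
  then have "singular_simplex k (subtopology (powertop_real UNIV) (standard_simplex n)) (vertex_map k f)"
    by (rule simplicial_imp_singular_simplex)
  then have 1: "singular_simplex k X (simplex_map k \<theta> (vertex_map k f))"
    using \<theta> by (intro singular_simplex_simplex_map) (auto simp: singular_simplex_def)
  have 2: "descending_weight (std_complex k) ?\<xi>'"
    using desc image_std_complex[OF _ f] unfolding descending_weight_def
    by (simp add: image_mono)
  have sing: "{v} \<in> std_complex k" if "v \<in> \<sigma>" "\<sigma> \<in> std_complex k" for v \<sigma>
    using that by (auto simp: std_complex_def)
  have 3: "divisible_weight (std_complex k) ?\<xi>'"
    unfolding divisible_weight_def
  proof
    fix \<sigma> assume \<sigma>: "\<sigma> \<in> std_complex k"
    obtain vs where vs: "vs \<noteq> []" "distinct vs" "set vs = \<sigma>"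
      "sorted_wrt (\<lambda>v w. \<xi> (f ` {v}) dvd \<xi> (f ` {w})) vs" "\<xi> (f ` \<sigma>) = \<xi> (f ` {hd vs})"
      using bspec[OF divisible_weight_pullback[OF div f, unfolded divisible_weight_def] \<sigma>] by blast
    have "sorted_wrt (\<lambda>v w. ?\<xi>' {v} dvd ?\<xi>' {w}) vs"
      using vs(4) by (rule sorted_wrt_mono_rel[rotated]) (use vs(3) sing[OF _ \<sigma>] in auto)
    moreover have "hd vs \<in> \<sigma>"
      using vs(1,3) by auto
    ultimately show "\<exists>us. us \<noteq> [] \<and> distinct us \<and> set us = \<sigma> \<and>
        sorted_wrt (\<lambda>v w. ?\<xi>' {v} dvd ?\<xi>' {w}) us \<and> ?\<xi>' \<sigma> = ?\<xi>' {hd us}"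
      using vs \<sigma> sing[OF _ \<sigma>] by (intro exI[of _ vs]) auto
  qed
  have 4: "?\<xi>' (std_carrier x) dvd lam (simplex_map k \<theta> (vertex_map k f) x)"
    if x: "x \<in> standard_simplex k" for x
    using lam[OF vertex_map_in_standard_simplex[OF x f]] x
    by (simp add: simplex_map_def std_carrier_in_std_complex std_carrier_vertex_map)
  show ?thesis
    using 1 2 3 4 by (auto simp: wface_def wsimplex_def s_eq)
qed


section \<open>Unweighted cochain identities\<close>

abbreviation skip :: "nat \<Rightarrow> nat \<Rightarrow> nat" where
  "skip j \<equiv> \<lambda>i. if i < j then i else Suc i"

text \<open>The operators of this section act on functions of arbitrary pairs, so the identities
  hold without membership hypotheses on \<open>s\<close>.\<close>

definition codiff :: "nat \<Rightarrow> ('a wsimplex \<Rightarrow> int) \<Rightarrow> 'a wsimplex \<Rightarrow> int" where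
  "codiff n G s = (\<Sum>j\<le>Suc n. (-1) ^ j * G (wface n (skip j) s))"

definition cup :: "nat \<Rightarrow> nat \<Rightarrow> ('a wsimplex \<Rightarrow> int) \<Rightarrow> ('a wsimplex \<Rightarrow> int) \<Rightarrow> 'a wsimplex \<Rightarrow> int" where
  "cup p q G H s = G (wface p (\<lambda>i. i) s) * H (wface q (\<lambda>i. p + i) s)"

lemma skip_image_subset: "skip j ` {..n} \<subseteq> {..Suc n}"
  by auto

lemma wface_skip: "wface n (skip j) (wface (Suc n) f s) = wface n (f \<circ> skip j) s"
  by (rule wface_wface[OF skip_image_subset])

lemma skip_image: "j \<le> Suc n \<Longrightarrow> skip j ` {..n} = {..Suc n} - {j}"
proof (intro equalityI subsetI)
  fix i assume "j \<le> Suc n" "i \<in> {..Suc n} - {j}"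
  then show "i \<in> skip j ` {..n}"
    by (intro image_eqI[of _ _ "if i < j then i else i - 1"]) auto
qed auto

lemma codiff_codiff: "codiff (Suc n) (codiff n G) s = 0"
proof -
  define F where "F = (\<lambda>(j, k). (-1) ^ (j + k) * G (wface n (skip j \<circ> skip k) s))"
  let ?S = "{..Suc (Suc n)} \<times> {..Suc n}"
  let ?L = "{(j, k). j \<le> Suc (Suc n) \<and> k < j}" and ?U = "{(j, k). k \<le> Suc n \<and> j \<le> k}"
  have fin: "finite ?L" "finite ?U"
    by (rule finite_subset[of _ "{..Suc (Suc n)} \<times> {..Suc (Suc n)}"], force, simp)+
  have "codiff (Suc n) (codiff n G) s = sum F ?S"
    by (simp add: codiff_def F_def sum_distrib_left wface_skip sum.cartesian_product
        power_add mult.assoc del: sum.atMost_Suc)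
  also have "?S = ?L \<union> ?U"
    by auto
  also have "sum F (?L \<union> ?U) = sum F ?L + sum F ?U"
    by (rule sum.union_disjoint[OF fin]) auto
  also have "sum F ?L = (\<Sum>x\<in>?U. - F x)"
  \<comment> \<open>For k < j the pairs (j, k) and (k, j - 1) delete the same two vertices, in
    opposite order; the exponents differ by one.\<close>
  proof (rule sum.reindex_bij_witness[where i = "\<lambda>(j, k). (Suc k, j)" and j = "\<lambda>(j, k). (k, j - 1)"])
    fix x assume "x \<in> ?L"
    then obtain j k where x: "x = (j, k)" "k < j" "j \<le> Suc (Suc n)" by auto
    then have "wface n (skip j \<circ> skip k) s = wface n (skip k \<circ> skip (j - 1)) s"
      by (intro wface_cong) auto
    moreover have "(-1) ^ (j + k) = - ((-1) ^ (k + (j - 1)) :: int)"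
      using x by (cases j) (simp_all add: power_add)
    ultimately show "- F ((\<lambda>(j, k). (k, j - 1)) x) = F x"
      by (simp add: F_def x)
  qed auto
  finally show ?thesis
    by (simp add: sum_negf)
qed

text \<open>Deleting vertex j affects only the front face if j is at most p, and only the back face
  otherwise. The right-hand side has two further terms, one from each coboundary, and these
  cancel.\<close>

lemma codiff_cup:
  "codiff (p + q) (cup p q G H) s = cup (Suc p) q (codiff p G) H s + (-1) ^ p * cup p (Suc q) G (codiff q H) s"
proof -
  define a where "a j = (-1) ^ j * (G (wface p (skip j) s) * H (wface q (\<lambda>i. Suc p + i) s))" for j
  define b where "b j = (-1) ^ j * (G (wface p (\<lambda>i. i) s) * H (wface q (\<lambda>i. p + skip j i) s))" for j
  have summand: "(-1) ^ j * cup p q G H (wface (p + q) (skip j) s) = (if j \<le> p then a j else (-1) ^ p * b (j - p))"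
    for j
  proof -
    have "cup p q G H (wface (p + q) (skip j) s)
        = G (wface p (skip j) s) * H (wface q (skip j \<circ> (\<lambda>i. p + i)) s)"
      by (subst cup_def, subst wface_wface, force, subst wface_wface, force) (simp add: o_def)
    moreover have "wface q (skip j \<circ> (\<lambda>i. p + i)) s = wface q (\<lambda>i. Suc p + i) s" if "j \<le> p"
      using that by (intro wface_cong) auto
    moreover have "wface p (skip j) s = wface p (\<lambda>i. i) s"
      "wface q (skip j \<circ> (\<lambda>i. p + i)) s = wface q (\<lambda>i. p + skip (j - p) i) s" if "j > p"
      using that by (auto intro!: wface_cong)
    moreover have "(-1) ^ j = (-1) ^ p * ((-1) ^ (j - p) :: int)" if "j > p"
      using that by (simp flip: power_add)
    ultimately show ?thesis
      by (simp add: a_def b_def)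
  qed
  have "codiff (p + q) (cup p q G H) s
      = (\<Sum>j\<in>{..p} \<union> {Suc p..Suc (p + q)}. if j \<le> p then a j else (-1) ^ p * b (j - p))"
    unfolding codiff_def summand by (rule sum.cong) auto
  also have "\<dots> = (\<Sum>j\<le>p. a j) + (\<Sum>j=Suc p..Suc (p + q). (-1) ^ p * b (j - p))"
    by (subst sum.union_disjoint) auto
  also have "(\<Sum>j=Suc p..Suc (p + q). (-1) ^ p * b (j - p)) = (\<Sum>j\<le>q. (-1) ^ p * b (Suc j))"
  proof (rule sum.reindex_bij_witness[where i = "\<lambda>j. Suc p + j" and j = "\<lambda>j. j - Suc p"])
    fix j assume "j \<in> {Suc p..Suc (p + q)}"
    then have "Suc (j - Suc p) = j - p" by auto
    then show "(-1) ^ p * b (Suc (j - Suc p)) = (-1) ^ p * b (j - p)"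
      by (simp only:)
  qed auto
  finally have lhs: "codiff (p + q) (cup p q G H) s = (\<Sum>j\<le>p. a j) + (-1) ^ p * (\<Sum>j\<le>q. b (Suc j))"
    by (simp add: sum_distrib_left)
  have "cup (Suc p) q (codiff p G) H s = (\<Sum>j\<le>Suc p. a j)"
    unfolding cup_def codiff_def a_def b_def
    by (subst wface_wface, force) (simp add: sum_distrib_right mult.assoc o_def del: sum.atMost_Suc)
  moreover have "cup p (Suc q) G (codiff q H) s = (\<Sum>j\<le>Suc q. b j)"
    unfolding cup_def codiff_def a_def b_def
    by (subst wface_wface, force) (simp add: sum_distrib_left mult.left_commute o_def del: sum.atMost_Suc)
  \<comment> \<open>The last face of the front factor and the zeroth face of the back factor leave
    the same product: the front p-face times the back q-face starting at p + 1. These are the two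
    further terms.\<close>
  moreover have "a (Suc p) = - ((-1) ^ p * b 0)"
  proof -
    have "wface p (skip (Suc p)) s = wface p (\<lambda>i. i) s"
      by (intro wface_cong) auto
    then show ?thesis by (simp add: a_def b_def)
  qed
  ultimately show ?thesis
    unfolding lhs by (simp add: sum.atMost_Suc_shift[of _ q] distrib_left del: sum.atMost_Suc)
      (simp add: distrib_left)
qed

text \<open>The sign of the permutation reversing \<open>n + 1\<close> vertices.\<close>

definition reversal_sign :: "nat \<Rightarrow> int" where
  "reversal_sign n = (-1) ^ (\<Sum>{..n})"

lemma reversal_sign_0 [simp]: "reversal_sign 0 = 1"
  by (simp add: reversal_sign_def)

lemma reversal_sign_Suc: "reversal_sign (Suc n) = (-1) ^ Suc n * reversal_sign n"
  by (simp add: reversal_sign_def power_add)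

text \<open>Triangular numbers satisfy t(p + q) = t(p) + t(q) + pq; the cross term is the sign in
  graded commutativity.\<close>

lemma reversal_sign_add: "reversal_sign (p + q) = (-1) ^ (p * q) * (reversal_sign p * reversal_sign q)"
proof (induction q)
  case (Suc q)
  then show ?case
    by (simp add: reversal_sign_Suc power_add algebra_simps)
qed simp

text \<open>
  The \<open>i\<close>-th simplex \<open>[v\<^sub>0, \<dots>, v\<^sub>i, w\<^sub>n, \<dots>, w\<^sub>i]\<close> of the subdivided prism \<open>\<Delta>\<^sup>n \<times> [0, 1]\<close>, projected
  to \<open>\<Delta>\<^sup>n\<close>.
\<close>

definition prism :: "nat \<Rightarrow> nat \<Rightarrow> nat \<Rightarrow> nat" where
  "prism n i j = (if j \<le> i then j else Suc (n + i) - j)"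

text \<open>The usual prism operator gives [v_0, ..., v_i, w_i, ..., w_n] the sign (-1)^i. Here the
  w's occur in reverse order, and \<open>reversal_sign (n - i)\<close> corrects for reversing these
  n - i + 1 vertices.\<close>

definition prism_op :: "nat \<Rightarrow> ('a wsimplex \<Rightarrow> int) \<Rightarrow> 'a wsimplex \<Rightarrow> int" where
  "prism_op n G s = (\<Sum>i\<le>n. (-1) ^ i * reversal_sign (n - i) * G (wface (Suc n) (prism n i) s))"

text \<open>Containment would suffice for the pullback to be a weighted simplex; surjectivity is
  what preserves the top weight.\<close>

lemma prism_image: "i \<le> n \<Longrightarrow> prism n i ` {..Suc n} = {..n}"
proof (intro equalityI subsetI)
  fix j assume "i \<le> n" "j \<in> {..n}"
  then show "j \<in> prism n i ` {..Suc n}"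
    by (intro image_eqI[of _ _ "if j \<le> i then j else Suc (n + i) - j"]) (auto simp: prism_def)
qed (auto simp: prism_def)

text \<open>The boundary of the subdivided prism: walls between consecutive prism simplices
  telescope, leaving the top (reversed) and the bottom, while faces over the boundary of the simplex
  cancel against the prism of the boundary. The bottom is the pullback along the identity, because
  \<open>s\<close> is not assumed extensional.\<close>

lemma prism_op_homotopy:
  fixes m :: nat
  defines "n \<equiv> Suc m"
  shows "prism_op n (codiff n G) s + codiff m (prism_op m G) s
    = reversal_sign n * G (wface n (\<lambda>i. n - i) s) - G (wface n (\<lambda>i. i) s)"
proof -
  define F where
    "F i j = (-1) ^ (i + j) * reversal_sign (n - i) * G (wface n (prism n i \<circ> skip j) s)" for i j
  define H where
    "H i k = (-1) ^ (i + k) * reversal_sign (m - i) * G (wface n (skip k \<circ> prism m i) s)" for i k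
  \<comment> \<open>The wall [v_0, ..., v_{i-1}, w_n, ..., w_i]. At i = 0 it is the reversed
    simplex; at i = n + 1 truncated subtraction makes the sign \<open>reversal_sign 0 = 1\<close>,
    as the bottom requires.\<close>
  define T where
    "T i = reversal_sign (n - i) * G (wface n (\<lambda>j. if j < i then j else n + i - j) s)" for i

  have first: "prism_op n (codiff n G) s = (\<Sum>i\<le>n. \<Sum>j\<le>Suc n. F i j)"
    unfolding prism_op_def codiff_def F_def
    by (simp add: wface_skip sum_distrib_left power_add mult_ac del: sum.atMost_Suc)
  have "codiff m (prism_op m G) s = (\<Sum>k\<le>n. \<Sum>i\<le>m. H i k)"
    unfolding prism_op_def codiff_def H_def n_def
    by (simp add: wface_wface prism_image sum_distrib_left power_add mult_ac del: sum.atMost_Suc)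
  also have "\<dots> = (\<Sum>i\<le>m. \<Sum>k\<le>n. H i k)"
    by (rule sum.swap)
  finally have second: "codiff m (prism_op m G) s = (\<Sum>i\<le>m. \<Sum>k\<le>n. H i k)" .

  \<comment> \<open>Deleting v_i at position i, or w_i at position n + 1, gives the two walls of the
    i-th prism simplex. Every other deletion is a face over the boundary.\<close>
  have row_F: "(\<Sum>j\<le>Suc n. F i j) = (\<Sum>j<i. F i j) + (T i - T (Suc i)) + (\<Sum>j\<in>{i<..n}. F i j)"
    if i: "i \<le> n" for i
  proof -
    have "{..Suc n} = {..<i} \<union> {i, Suc n} \<union> {i<..n}"
      using i by auto
    then have "(\<Sum>j\<le>Suc n. F i j) = (\<Sum>j\<in>{..<i} \<union> {i, Suc n} \<union> {i<..n}. F i j)"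
      by (simp only:)
    also have "\<dots> = (\<Sum>j<i. F i j) + (F i i + F i (Suc n)) + (\<Sum>j\<in>{i<..n}. F i j)"
    proof -
      have "(\<Sum>j\<in>{i, Suc n}. F i j) = F i i + F i (Suc n)"
        using i by (subst sum.insert) auto
      then show ?thesis
        using i by (subst sum.union_disjoint, simp, simp, force)+ simp
    qed
    also have "F i i = T i"
    proof -
      have "wface n (prism n i \<circ> skip i) s = wface n (\<lambda>j. if j < i then j else n + i - j) s"
        by (intro wface_cong) (auto simp: prism_def)
      then show ?thesis
        by (simp add: F_def T_def power_add)
    qed
    also have "F i (Suc n) = - T (Suc i)"
    proof -
      have "wface n (prism n i \<circ> skip (Suc n)) s = wface n (\<lambda>j. if j < Suc i then j else n + Suc i - j) s"
        by (intro wface_cong) (auto simp: prism_def)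
      moreover have "(-1) ^ (i + Suc n) * reversal_sign (n - i) = - reversal_sign (n - Suc i)"
      \<comment> \<open>For i = n the difference \<open>n - Suc i\<close> is truncated to 0, so the
        recursion for the sign is available only below n.\<close>
      proof (cases "i = n")
        case True
        then show ?thesis by (simp add: power_add)
      next
        case False
        then obtain d where d: "n = Suc (i + d)"
          using i less_iff_Suc_add[of i n] by auto
        show ?thesis
          by (simp add: d Suc_diff_le reversal_sign_Suc power_add)
      qed
      ultimately show ?thesis
        by (simp add: F_def T_def)
    qed
    finally show ?thesis by simp
  qed

  have row_H: "(\<Sum>k\<le>n. H i k) = - (\<Sum>j<Suc i. F (Suc i) j) - (\<Sum>j\<in>{i<..n}. F i j)" if i: "i \<le> m" for i
  proof -
    obtain d where d: "m = i + d"
      using le_Suc_ex[OF i] by blast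
    have "{..n} = {..<Suc i} \<union> {i<..n}"
      using i by (auto simp: n_def)
    then have "(\<Sum>k\<le>n. H i k) = (\<Sum>k<Suc i. H i k) + (\<Sum>k\<in>{i<..n}. H i k)"
      by (simp only:) (subst sum.union_disjoint, auto)
    \<comment> \<open>A vertex inserted at or below position i shifts the doubled vertex up by one,
      so these faces belong to the next prism simplex.\<close>
    also have "(\<Sum>k<Suc i. H i k) = (\<Sum>k<Suc i. - F (Suc i) k)"
    proof (rule sum.cong)
      fix k assume k: "k \<in> {..<Suc i}"
      then have "wface n (skip k \<circ> prism m i) s = wface n (prism n (Suc i) \<circ> skip k) s"
        using i by (intro wface_cong) (auto simp: prism_def n_def)
      then show "H i k = - F (Suc i) k"
        by (simp add: H_def F_def n_def)
    qed simp
    also have "(\<Sum>k\<in>{i<..n}. H i k) = (\<Sum>j\<in>{i<..n}. - F i j)"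
    \<comment> \<open>In the reversed half w_k stands at position n + 1 + i - k, so the deletion
      index is reflected.\<close>
    proof (rule sum.reindex_bij_witness[where i = "\<lambda>j. n + Suc i - j" and j = "\<lambda>k. n + Suc i - k"])
      fix k assume k: "k \<in> {i<..n}"
      then have "wface n (skip k \<circ> prism m i) s = wface n (prism n i \<circ> skip (n + Suc i - k)) s"
        using i by (intro wface_cong) (auto simp: prism_def n_def)
      moreover obtain e where "n = k + e"
        using k le_Suc_ex[of k n] by auto
      moreover obtain c where "k = Suc (i + c)"
        using k less_iff_Suc_add[of i k] by auto
      \<comment> \<open>With all differences named, no truncated subtraction remains in the
        exponents and the signs are settled by parity.\<close>
      ultimately show "- F i (n + Suc i - k) = H i k"
        by (cases "even i"; cases "even e")
          (simp_all add: H_def F_def n_def d Suc_diff_le reversal_sign_Suc power_add)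
    qed auto
    finally show ?thesis
      by (simp add: sum_negf)
  qed

  have "prism_op n (codiff n G) s = (\<Sum>i\<le>n. (\<Sum>j<i. F i j) + (T i - T (Suc i)) + (\<Sum>j\<in>{i<..n}. F i j))"
    unfolding first by (intro sum.cong row_F) auto
  also have "\<dots> = (\<Sum>i\<le>n. \<Sum>j<i. F i j) + (\<Sum>i\<le>n. T i - T (Suc i)) + (\<Sum>i\<le>n. \<Sum>j\<in>{i<..n}. F i j)"
    by (simp only: sum.distrib)
  \<comment> \<open>The last row has no upper part and row 0 no lower part, so both double sums run
    over as many rows as \<open>H\<close> has.\<close>
  also have "(\<Sum>i\<le>n. \<Sum>j\<in>{i<..n}. F i j) = (\<Sum>i\<le>m. \<Sum>j\<in>{i<..n}. F i j)"
    by (simp add: n_def)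
  also have "(\<Sum>i\<le>n. \<Sum>j<i. F i j) = (\<Sum>i\<le>m. \<Sum>j<Suc i. F (Suc i) j)"
    unfolding n_def by (subst sum.atMost_Suc_shift) simp
  also have "(\<Sum>i\<le>n. T i - T (Suc i)) = T 0 - T (Suc n)"
    by (rule sum_telescope)
  finally have 1: "prism_op n (codiff n G) s = (\<Sum>i\<le>m. \<Sum>j<Suc i. F (Suc i) j) + (T 0 - T (Suc n))
      + (\<Sum>i\<le>m. \<Sum>j\<in>{i<..n}. F i j)" .
  have "codiff m (prism_op m G) s = (\<Sum>i\<le>m. - (\<Sum>j<Suc i. F (Suc i) j) - (\<Sum>j\<in>{i<..n}. F i j))"
    unfolding second by (intro sum.cong row_H) auto
  then have "prism_op n (codiff n G) s + codiff m (prism_op m G) s = T 0 - T (Suc n)"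
    unfolding 1 by (simp only: sum_subtractf sum_negf)
  moreover have "wface n (\<lambda>j. if j < Suc n then j else n + Suc n - j) s = wface n (\<lambda>i. i) s"
    by (intro wface_cong) auto
  ultimately show ?thesis
    by (simp add: T_def)
qed

text \<open>The front p-face of the reversed simplex is the reversed back p-face of the original,
  and likewise for q; commutativity of integer multiplication exchanges the factors.\<close>

lemma cup_reversal:
  "cup p q G H (wface (p + q) (\<lambda>i. p + q - i) s)
    = cup q p (\<lambda>t. H (wface q (\<lambda>i. q - i) t)) (\<lambda>t. G (wface p (\<lambda>i. p - i) t)) s"
proof -
  have "wface p (\<lambda>i. i) (wface (p + q) (\<lambda>i. p + q - i) s) = wface p (\<lambda>i. p - i) (wface p (\<lambda>i. q + i) s)"
    by (subst wface_wface, force, subst wface_wface, force, rule wface_cong) auto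
  moreover have "wface q (\<lambda>i. p + i) (wface (p + q) (\<lambda>i. p + q - i) s) = wface q (\<lambda>i. q - i) (wface q (\<lambda>i. i) s)"
    by (subst wface_wface, force, subst wface_wface, force, rule wface_cong) auto
  ultimately show ?thesis
    by (simp add: cup_def)
qed


section \<open>Weighted cochains on generators\<close>

text \<open>
  Multiplying a cochain by the weight of the whole simplex turns the weighted coboundary and cup product
  into the unweighted ones; since weights are positive, identities can be checked after this.
\<close>

definition weigh :: "nat \<Rightarrow> ('a wsimplex \<Rightarrow> int) \<Rightarrow> 'a wsimplex \<Rightarrow> int" where
  "weigh n g s = int (snd s {..n}) * g s"

definition wcodiff :: "nat \<Rightarrow> ('a wsimplex \<Rightarrow> int) \<Rightarrow> 'a wsimplex \<Rightarrow> int" where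
  "wcodiff n g s = (\<Sum>j\<le>Suc n. (-1) ^ j * int (snd s ({..Suc n} - {j}) div snd s {..Suc n}) * g (wface n (skip j) s))"

definition weighted_cup ::
  "nat \<Rightarrow> nat \<Rightarrow> ('a wsimplex \<Rightarrow> int) \<Rightarrow> ('a wsimplex \<Rightarrow> int) \<Rightarrow> 'a wsimplex \<Rightarrow> int" where
  "weighted_cup p q g h s =
     int (snd s {..p} * snd s {p..p + q} div snd s {..p + q}) *
     g (wface p (\<lambda>i. i) s) * h (wface q (\<lambda>i. p + i) s)"

definition reversal :: "nat \<Rightarrow> ('a wsimplex \<Rightarrow> int) \<Rightarrow> 'a wsimplex \<Rightarrow> int" where
  "reversal n g s = reversal_sign n * g (wface n (\<lambda>i. n - i) s)"

lemma weight_pos: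
  assumes "s \<in> wsimplex n X lam"
  shows "snd s {..n} > 0"
  using assms by (auto simp: wsimplex_def descending_weight_def atMost_std_complex)

lemma weight_dvd:
  assumes "s \<in> wsimplex n X lam" "\<sigma> \<in> std_complex n"
  shows "snd s {..n} dvd snd s \<sigma>"
proof -
  have "\<sigma> \<subseteq> {..n}"
    using assms(2) by (simp add: std_complex_def)
  then show ?thesis
    using assms by (auto simp: wsimplex_def descending_weight_def atMost_std_complex)
qed

lemma weigh_cancel:
  assumes "s \<in> wsimplex n X lam"
  shows "weigh n g s = weigh n h s \<longleftrightarrow> g s = h s"
  using weight_pos[OF assms] by (simp add: weigh_def)

lemma weigh_wface: "weigh k g (wface k f s) = int (snd s (f ` {..k})) * g (wface k f s)"
  by (simp add: weigh_def snd_wface atMost_std_complex)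

text \<open>The top weight cancels the denominator exactly, by divisibility, and leaves the weight
  of the face, which is the scaling factor of that face itself.\<close>

lemma weigh_wcodiff:
  assumes s: "s \<in> wsimplex (Suc n) X lam"
  shows "weigh (Suc n) (wcodiff n g) s = codiff n (weigh n g) s"
proof -
  have "int (snd s {..Suc n}) * ((-1) ^ j * int (snd s ({..Suc n} - {j}) div snd s {..Suc n}) * g (wface n (skip j) s))
      = (-1) ^ j * weigh n g (wface n (skip j) s)" if "j \<in> {..Suc n}" for j
  proof -
    have "skip j ` {..n} \<in> std_complex (Suc n)"
      by (intro image_std_complex[OF atMost_std_complex] skip_image_subset)
    then have "snd s {..Suc n} dvd snd s (skip j ` {..n})"
      by (rule weight_dvd[OF s])
    moreover have "skip j ` {..n} = {..Suc n} - {j}"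
      using that by (intro skip_image) simp
    ultimately have "int (snd s (skip j ` {..n})) = int (snd s {..Suc n}) * int (snd s ({..Suc n} - {j}) div snd s {..Suc n})"
      by (simp flip: of_nat_mult)
    then show ?thesis
      unfolding weigh_wface by (simp only: mult_ac)
  qed
  then show ?thesis
    unfolding codiff_def weigh_def[of "Suc n"] wcodiff_def sum_distrib_left by (rule sum.cong[OF refl])
qed

lemma weigh_cup:
  assumes s: "s \<in> wsimplex (p + q) X lam"
  shows "weigh (p + q) (weighted_cup p q g h) s = cup p q (weigh p g) (weigh q h) s"
proof -
  \<comment> \<open>Divisibility of the front weight by the top weight already makes the quotient of
    the product exact.\<close>
  have "{..p} \<in> std_complex (p + q)"
    by (auto simp: std_complex_def)
  then have "int (snd s {..p + q}) * int (snd s {..p} * snd s {p..p + q} div snd s {..p + q})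
      = int (snd s {..p}) * int (snd s {p..p + q})"
    using weight_dvd[OF s] by (simp flip: of_nat_mult)
  moreover have "(+) p ` {..q} = {p..p + q}"
    using image_add_atLeastAtMost[of p 0 q] by (simp add: atMost_atLeast0)
  ultimately show ?thesis
    unfolding cup_def weigh_wface by (simp add: weigh_def weighted_cup_def mult.assoc[symmetric])
qed

lemma weigh_prism_op: "weigh n (prism_op n g) s = prism_op n (weigh (Suc n) g) s"
  unfolding prism_op_def weigh_wface
  by (simp add: weigh_def prism_image sum_distrib_left mult_ac)

lemma weigh_reversal:
  "weigh n (reversal n g) s = reversal_sign n * weigh n g (wface n (\<lambda>i. n - i) s)"
proof -
  have "(\<lambda>i. n - i) ` {..n} = {..n}"
  proof (intro equalityI subsetI)
    fix i assume "i \<in> {..n}"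
    then show "i \<in> (\<lambda>i. n - i) ` {..n}"
      by (intro image_eqI[of _ _ "n - i"]) auto
  qed auto
  then show ?thesis
    by (simp add: weigh_wface) (simp add: weigh_def reversal_def)
qed

text \<open>Clearing weights is justified only on weighted simplices; to do it under an outer
  coboundary, the faces must again be weighted simplices.\<close>

lemma codiff_cong:
  assumes "\<And>t. t \<in> wsimplex n X lam \<Longrightarrow> G t = H t" "s \<in> wsimplex (Suc n) X lam"
  shows "codiff n G s = codiff n H s"
  using assms wface_in_wsimplex[OF assms(2) skip_image_subset] unfolding codiff_def
  by (intro sum.cong) auto

lemma wcodiff_cong:
  assumes "\<And>t. t \<in> wsimplex n X lam \<Longrightarrow> g t = h t" "s \<in> wsimplex (Suc n) X lam"
  shows "wcodiff n g s = wcodiff n h s"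
  using assms wface_in_wsimplex[OF assms(2) skip_image_subset] unfolding wcodiff_def
  by (intro sum.cong) auto

lemma front_face_in_wsimplex:
  "s \<in> wsimplex (p + q) X lam \<Longrightarrow> wface p (\<lambda>i. i) s \<in> wsimplex p X lam"
  by (rule wface_in_wsimplex) auto

lemma back_face_in_wsimplex:
  "s \<in> wsimplex (p + q) X lam \<Longrightarrow> wface q (\<lambda>i. p + i) s \<in> wsimplex q X lam"
  by (rule wface_in_wsimplex) auto

lemma weighted_cup_cong:
  assumes "\<And>t. t \<in> wsimplex p X lam \<Longrightarrow> g t = g' t" "\<And>t. t \<in> wsimplex q X lam \<Longrightarrow> h t = h' t"
    and "s \<in> wsimplex (p + q) X lam"
  shows "weighted_cup p q g h s = weighted_cup p q g' h' s"
  using assms by (simp add: weighted_cup_def front_face_in_wsimplex back_face_in_wsimplex)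

section \<open>Transfer of the identities to weighted cochains\<close>

lemma wcodiff_wcodiff:
  assumes s: "s \<in> wsimplex (Suc (Suc n)) X lam"
  shows "wcodiff (Suc n) (wcodiff n g) s = 0"
proof -
  have "weigh (Suc (Suc n)) (wcodiff (Suc n) (wcodiff n g)) s = codiff (Suc n) (codiff n (weigh n g)) s"
    unfolding weigh_wcodiff[OF s] by (rule codiff_cong[OF weigh_wcodiff s])
  then show ?thesis
    using weight_pos[OF s] by (simp add: codiff_codiff weigh_def)
qed

lemma wcodiff_weighted_cup:
  assumes s: "s \<in> wsimplex (Suc (p + q)) X lam"
  shows "wcodiff (p + q) (weighted_cup p q g h) s
    = weighted_cup (Suc p) q (wcodiff p g) h s + (-1) ^ p * weighted_cup p (Suc q) g (wcodiff q h) s"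
proof -
  have sp: "s \<in> wsimplex (Suc p + q) X lam" and sq: "s \<in> wsimplex (p + Suc q) X lam"
    using s by simp_all
  let ?G = "weigh p g" and ?H = "weigh q h"
  have "weigh (Suc (p + q)) (wcodiff (p + q) (weighted_cup p q g h)) s = codiff (p + q) (cup p q ?G ?H) s"
    unfolding weigh_wcodiff[OF s] by (rule codiff_cong[OF weigh_cup s])
  also have "\<dots> = cup (Suc p) q (codiff p ?G) ?H s + (-1) ^ p * cup p (Suc q) ?G (codiff q ?H) s"
    by (rule codiff_cup)
  also have "cup (Suc p) q (codiff p ?G) ?H s = cup (Suc p) q (weigh (Suc p) (wcodiff p g)) ?H s"
    by (simp only: cup_def weigh_wcodiff[OF front_face_in_wsimplex[OF sp]])
  also have "\<dots> = weigh (Suc p + q) (weighted_cup (Suc p) q (wcodiff p g) h) s"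
    by (rule weigh_cup[OF sp, symmetric])
  also have "cup p (Suc q) ?G (codiff q ?H) s = cup p (Suc q) ?G (weigh (Suc q) (wcodiff q h)) s"
    by (simp only: cup_def weigh_wcodiff[OF back_face_in_wsimplex[OF sq]])
  also have "\<dots> = weigh (p + Suc q) (weighted_cup p (Suc q) g (wcodiff q h)) s"
    by (rule weigh_cup[OF sq, symmetric])
  finally have "weigh (Suc (p + q)) (wcodiff (p + q) (weighted_cup p q g h)) s
    = weigh (Suc (p + q)) (\<lambda>s. weighted_cup (Suc p) q (wcodiff p g) h s
        + (-1) ^ p * weighted_cup p (Suc q) g (wcodiff q h) s) s"
    by (simp add: weigh_def distrib_left mult.left_commute)
  then show ?thesis
    unfolding weigh_cancel[OF s] .
qed

lemma reversal_homotopy: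
  assumes s: "s \<in> wsimplex (Suc m) X lam"
  shows "prism_op (Suc m) (wcodiff (Suc m) g) s + wcodiff m (prism_op m g) s = reversal (Suc m) g s - g s"
proof -
  have "weigh (Suc m) (prism_op (Suc m) (wcodiff (Suc m) g)) s
      = prism_op (Suc m) (codiff (Suc m) (weigh (Suc m) g)) s"
  proof -
    \<comment> \<open>Here the coboundary is evaluated on degenerate simplices, so its weights are
      cleared by divisibility of the pulled-back weight.\<close>
    have "weigh (Suc (Suc m)) (wcodiff (Suc m) g) (wface (Suc (Suc m)) (prism (Suc m) i) s)
        = codiff (Suc m) (weigh (Suc m) g) (wface (Suc (Suc m)) (prism (Suc m) i) s)" if "i \<le> Suc m" for i
      by (rule weigh_wcodiff[OF wface_in_wsimplex[OF s]]) (simp add: prism_image[OF that])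
    then show ?thesis
      unfolding weigh_prism_op prism_op_def by (intro sum.cong) auto
  qed
  moreover have "weigh (Suc m) (wcodiff m (prism_op m g)) s = codiff m (prism_op m (weigh (Suc m) g)) s"
    unfolding weigh_wcodiff[OF s] by (rule codiff_cong[OF weigh_prism_op s])
  moreover have "weigh (Suc m) g (wface (Suc m) (\<lambda>i. i) s) = weigh (Suc m) g s"
    by (simp add: wface_id[OF s])
  ultimately have "weigh (Suc m) (\<lambda>s. prism_op (Suc m) (wcodiff (Suc m) g) s + wcodiff m (prism_op m g) s) s
      = weigh (Suc m) (\<lambda>s. reversal (Suc m) g s - g s) s"
    using prism_op_homotopy[of m "weigh (Suc m) g" s] weigh_reversal[of "Suc m" g s]
    by (simp add: weigh_def distrib_left right_diff_distrib)
  then show ?thesis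
    unfolding weigh_cancel[OF s] .
qed

text \<open>Reversal is a strict antihomomorphism up to sign at the level of cochains; a homotopy is
  needed only to compare it with the identity.\<close>

lemma reversal_weighted_cup:
  assumes s: "s \<in> wsimplex (p + q) X lam"
  shows "reversal (p + q) (weighted_cup p q g h) s
    = (-1) ^ (p * q) * weighted_cup q p (reversal q h) (reversal p g) s"
proof -
  have s': "s \<in> wsimplex (q + p) X lam"
    using s by (simp add: add.commute)
  have "wface (p + q) (\<lambda>i. p + q - i) s \<in> wsimplex (p + q) X lam"
    by (rule wface_in_wsimplex[OF s]) auto
  then have "weigh (p + q) (reversal (p + q) (weighted_cup p q g h)) s
      = reversal_sign (p + q) * cup q p (\<lambda>t. weigh q h (wface q (\<lambda>i. q - i) t))
          (\<lambda>t. weigh p g (wface p (\<lambda>i. p - i) t)) s"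
    by (simp add: weigh_reversal weigh_cup cup_reversal)
  also have "\<dots> = (-1) ^ (p * q) * cup q p (weigh q (reversal q h)) (weigh p (reversal p g)) s"
    by (simp add: reversal_sign_add cup_def weigh_reversal mult_ac)
  also have "\<dots> = (-1) ^ (p * q) * weigh (q + p) (weighted_cup q p (reversal q h) (reversal p g)) s"
    by (simp only: weigh_cup[OF s'])
  also have "\<dots> = weigh (p + q) (\<lambda>s. (-1) ^ (p * q) * weighted_cup q p (reversal q h) (reversal p g) s) s"
    by (simp add: weigh_def add.commute mult_ac)
  finally show ?thesis
    unfolding weigh_cancel[OF s] .
qed

lemma wcodiff_add: "wcodiff n (\<lambda>s. g s + h s) s = wcodiff n g s + wcodiff n h s"
  by (simp add: wcodiff_def distrib_left sum.distrib del: sum.atMost_Suc)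

lemma wcodiff_scale: "wcodiff n (\<lambda>s. c * g s) s = c * wcodiff n g s"
  by (simp add: wcodiff_def sum_distrib_left mult_ac del: sum.atMost_Suc)

section \<open>Cocycles and exact cochains on generators\<close>

definition cocycle :: "nat \<Rightarrow> 'a topology \<Rightarrow> ('a \<Rightarrow> nat) \<Rightarrow> ('a wsimplex \<Rightarrow> int) \<Rightarrow> bool" where
  "cocycle n X lam g \<longleftrightarrow> (\<forall>s\<in>wsimplex (Suc n) X lam. wcodiff n g s = 0)"

definition exact :: "nat \<Rightarrow> 'a topology \<Rightarrow> ('a \<Rightarrow> nat) \<Rightarrow> ('a wsimplex \<Rightarrow> int) \<Rightarrow> bool" where
  "exact n X lam g \<longleftrightarrow>
     (case n of
        0 \<Rightarrow> \<forall>s\<in>wsimplex 0 X lam. g s = 0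
      | Suc m \<Rightarrow> \<exists>h. \<forall>s\<in>wsimplex (Suc m) X lam. g s = wcodiff m h s)"

lemma exactI_zero:
  assumes "\<And>s. s \<in> wsimplex n X lam \<Longrightarrow> g s = 0"
  shows "exact n X lam g"
proof (cases n)
  case (Suc m)
  have "wcodiff m (\<lambda>_. 0) s = 0" for s :: "'a wsimplex"
    by (simp add: wcodiff_def del: sum.atMost_Suc)
  then show ?thesis
    using assms unfolding exact_def Suc nat.case by (intro exI[of _ "\<lambda>_. 0"]) auto
qed (use assms in \<open>simp add: exact_def\<close>)

lemma exactI:
  assumes "\<And>s. s \<in> wsimplex (Suc m) X lam \<Longrightarrow> g s = wcodiff m h s"
  shows "exact (Suc m) X lam g"
  using assms by (auto simp: exact_def)

lemma exactE:
  assumes "exact (Suc m) X lam g"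
  obtains h where "\<And>s. s \<in> wsimplex (Suc m) X lam \<Longrightarrow> g s = wcodiff m h s"
  using assms unfolding exact_def nat.case by blast

lemma exact_cong:
  assumes "exact n X lam g" "\<And>s. s \<in> wsimplex n X lam \<Longrightarrow> g s = h s"
  shows "exact n X lam h"
  using assms by (cases n) (auto simp: exact_def)

lemma exact_add:
  assumes "exact n X lam g" "exact n X lam h"
  shows "exact n X lam (\<lambda>s. g s + h s)"
proof (cases n)
  case (Suc m)
  obtain g' where g': "\<And>s. s \<in> wsimplex (Suc m) X lam \<Longrightarrow> g s = wcodiff m g' s"
    using assms(1) unfolding Suc by (rule exactE) (rule that)
  obtain h' where h': "\<And>s. s \<in> wsimplex (Suc m) X lam \<Longrightarrow> h s = wcodiff m h' s"
    using assms(2) unfolding Suc by (rule exactE) (rule that)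
  show ?thesis
    unfolding Suc by (intro exactI[where h = "\<lambda>s. g' s + h' s"]) (simp add: wcodiff_add g' h')
qed (use assms in \<open>simp add: exact_def\<close>)

lemma exact_scale:
  assumes "exact n X lam g"
  shows "exact n X lam (\<lambda>s. c * g s)"
proof (cases n)
  case (Suc m)
  obtain g' where g': "\<And>s. s \<in> wsimplex (Suc m) X lam \<Longrightarrow> g s = wcodiff m g' s"
    using assms unfolding Suc by (rule exactE) (rule that)
  show ?thesis
    unfolding Suc by (intro exactI[where h = "\<lambda>s. c * g' s"]) (simp add: wcodiff_scale g')
qed (use assms in \<open>simp add: exact_def\<close>)

lemma cocycle_if_exact:
  assumes "exact n X lam g"
  shows "cocycle n X lam g"
proof (cases n)
  case 0
  have "wcodiff 0 g s = 0" if "s \<in> wsimplex (Suc 0) X lam" for s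
  proof -
    \<comment> \<open>\<open>g\<close> is known to vanish only on weighted simplices, so it is
      replaced there by a multiple that vanishes everywhere.\<close>
    have "wcodiff 0 g s = wcodiff 0 (\<lambda>s. 0 * g s) s"
      using assms 0 by (intro wcodiff_cong[OF _ that]) (simp add: exact_def)
    also have "\<dots> = 0"
      by (subst wcodiff_scale) simp
    finally show ?thesis .
  qed
  then show ?thesis
    by (simp add: cocycle_def 0)
next
  case (Suc m)
  obtain h where h: "\<And>s. s \<in> wsimplex (Suc m) X lam \<Longrightarrow> g s = wcodiff m h s"
    using assms unfolding Suc by (rule exactE) (rule that)
  have "wcodiff (Suc m) g s = 0" if "s \<in> wsimplex (Suc (Suc m)) X lam" for s
    using wcodiff_cong[OF h that] wcodiff_wcodiff[OF that, of h] by simp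
  then show ?thesis
    by (simp add: cocycle_def Suc)
qed

lemma cocycle_add: "cocycle n X lam g \<Longrightarrow> cocycle n X lam h \<Longrightarrow> cocycle n X lam (\<lambda>s. g s + h s)"
  by (simp add: cocycle_def wcodiff_add)

lemma cocycle_scale: "cocycle n X lam g \<Longrightarrow> cocycle n X lam (\<lambda>s. c * g s)"
  by (simp add: cocycle_def wcodiff_scale)

lemma cocycle_cohomologous:
  assumes "cocycle n X lam g" "exact n X lam (\<lambda>s. h s - g s)"
  shows "cocycle n X lam h"
  using cocycle_add[OF assms(1) cocycle_if_exact[OF assms(2)]] by simp

section \<open>Descent of the cup product to cohomology\<close>

lemma weighted_cup_zero_left:
  assumes "\<And>t. t \<in> wsimplex p X lam \<Longrightarrow> g t = 0" "s \<in> wsimplex (p + q) X lam"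
  shows "weighted_cup p q g h s = 0"
  using assms by (simp add: weighted_cup_def front_face_in_wsimplex)

lemma weighted_cup_zero_right:
  assumes "\<And>t. t \<in> wsimplex q X lam \<Longrightarrow> h t = 0" "s \<in> wsimplex (p + q) X lam"
  shows "weighted_cup p q g h s = 0"
  using assms by (simp add: weighted_cup_def back_face_in_wsimplex)

lemma cocycle_weighted_cup:
  assumes "cocycle p X lam g" "cocycle q X lam h"
  shows "cocycle (p + q) X lam (weighted_cup p q g h)"
  unfolding cocycle_def
proof
  fix s assume s: "s \<in> wsimplex (Suc (p + q)) X lam"
  have "weighted_cup (Suc p) q (wcodiff p g) h s = 0"
    using assms s by (intro weighted_cup_zero_left) (auto simp: cocycle_def)
  moreover have "weighted_cup p (Suc q) g (wcodiff q h) s = 0"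
    using assms s by (intro weighted_cup_zero_right) (auto simp: cocycle_def)
  ultimately show "wcodiff (p + q) (weighted_cup p q g h) s = 0"
    by (simp add: wcodiff_weighted_cup[OF s])
qed

lemma exact_weighted_cup_left:
  assumes g: "exact p X lam g" and h: "cocycle q X lam h"
  shows "exact (p + q) X lam (weighted_cup p q g h)"
proof (cases p)
  case 0
  then show ?thesis
    using g by (intro exactI_zero weighted_cup_zero_left) (auto simp: exact_def)
next
  case (Suc m)
  obtain k where k: "\<And>s. s \<in> wsimplex (Suc m) X lam \<Longrightarrow> g s = wcodiff m k s"
    using g unfolding Suc by (rule exactE) (rule that)
  have "weighted_cup (Suc m) q g h s = wcodiff (m + q) (weighted_cup m q k h) s"
    if s: "s \<in> wsimplex (Suc (m + q)) X lam" for s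
  proof -
    have "weighted_cup m (Suc q) k (wcodiff q h) s = 0"
      using h s by (intro weighted_cup_zero_right) (auto simp: cocycle_def)
    moreover have "weighted_cup (Suc m) q g h s = weighted_cup (Suc m) q (wcodiff m k) h s"
      using k s by (intro weighted_cup_cong) auto
    ultimately show ?thesis
      by (simp add: wcodiff_weighted_cup[OF s])
  qed
  then show ?thesis
    unfolding Suc add_Suc by (rule exactI)
qed

lemma exact_weighted_cup_right:
  assumes g: "cocycle p X lam g" and h: "exact q X lam h"
  shows "exact (p + q) X lam (weighted_cup p q g h)"
proof (cases q)
  case 0
  then show ?thesis
    using h by (intro exactI_zero weighted_cup_zero_right) (auto simp: exact_def)
next
  case (Suc m)
  obtain k where k: "\<And>s. s \<in> wsimplex (Suc m) X lam \<Longrightarrow> h s = wcodiff m k s"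
    using h unfolding Suc by (rule exactE) (rule that)
  \<comment> \<open>The sign in the primitive cancels the one that the Leibniz rule attaches to the
    right factor.\<close>
  have "weighted_cup p (Suc m) g h s = wcodiff (p + m) (\<lambda>s. (-1) ^ p * weighted_cup p m g k s) s"
    if s: "s \<in> wsimplex (Suc (p + m)) X lam" for s
  proof -
    have "weighted_cup (Suc p) m (wcodiff p g) k s = 0"
      using g s by (intro weighted_cup_zero_left) (auto simp: cocycle_def)
    moreover have "weighted_cup p (Suc m) g h s = weighted_cup p (Suc m) g (wcodiff m k) s"
      using k s by (intro weighted_cup_cong) auto
    ultimately show ?thesis
      by (simp add: wcodiff_weighted_cup[OF s] wcodiff_scale)
  qed
  then show ?thesis
    unfolding Suc add_Suc_right by (rule exactI)
qed

text \<open>The difference is (g' - g) cup h' plus g cup (h' - h), so the new \<open>h'\<close> must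
  be a cocycle as well.\<close>

lemma weighted_cup_cohomologous:
  assumes "cocycle p X lam g" "cocycle q X lam h"
    and g': "exact p X lam (\<lambda>s. g' s - g s)" and h': "exact q X lam (\<lambda>s. h' s - h s)"
  shows "exact (p + q) X lam (\<lambda>s. weighted_cup p q g' h' s - weighted_cup p q g h s)"
proof -
  have "cocycle q X lam h'"
    using assms(2) h' by (rule cocycle_cohomologous)
  from exact_add[OF exact_weighted_cup_left[OF g' this] exact_weighted_cup_right[OF assms(1) h']]
  show ?thesis
    by (rule exact_cong) (simp add: weighted_cup_def algebra_simps)
qed

text \<open>For a cocycle one term of the homotopy vanishes and \<open>prism_op m g\<close> is a
  primitive; in degree 0 the reversal is the identity.\<close>

lemma exact_reversal:
  assumes "cocycle n X lam g"
  shows "exact n X lam (\<lambda>s. reversal n g s - g s)"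
proof (cases n)
  case 0
  have "reversal 0 g s = g s" if s: "s \<in> wsimplex 0 X lam" for s
  proof -
    have "wface 0 (\<lambda>i. 0 - i) s = wface 0 (\<lambda>i. i) s"
      by (rule wface_cong) simp
    then show ?thesis
      by (simp add: reversal_def wface_id[OF s])
  qed
  then show ?thesis
    unfolding 0 by (intro exactI_zero) simp
next
  case (Suc m)
  have "reversal (Suc m) g s - g s = wcodiff m (prism_op m g) s" if s: "s \<in> wsimplex (Suc m) X lam" for s
  proof -
    have "wface (Suc (Suc m)) (prism (Suc m) i) s \<in> wsimplex (Suc (Suc m)) X lam" if "i \<le> Suc m" for i
      by (rule wface_in_wsimplex[OF s]) (simp add: prism_image[OF that])
    then have "prism_op (Suc m) (wcodiff (Suc m) g) s = 0"
      using assms unfolding Suc cocycle_def prism_op_def by (intro sum.neutral) auto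
    then show ?thesis
      using reversal_homotopy[OF s, of g] by simp
  qed
  then show ?thesis
    unfolding Suc by (rule exactI)
qed

text \<open>Three comparisons: the product with its reversal, the reversal with the signed product
  of the reversed factors in opposite order (an equality), and the reversed factors with the
  original ones.\<close>

lemma weighted_cup_graded_commutative:
  assumes g: "cocycle p X lam g" and h: "cocycle q X lam h"
  shows "exact (p + q) X lam (\<lambda>s. weighted_cup p q g h s - (-1) ^ (p * q) * weighted_cup q p h g s)"
proof -
  have "exact (q + p) X lam (\<lambda>s. weighted_cup q p (reversal q h) (reversal p g) s - weighted_cup q p h g s)"
    by (rule weighted_cup_cohomologous[OF h g exact_reversal[OF h] exact_reversal[OF g]])
  then have "exact (p + q) X lam (\<lambda>s. (-1) ^ (p * q) *
      (weighted_cup q p (reversal q h) (reversal p g) s - weighted_cup q p h g s))"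
    unfolding add.commute[of q p] by (rule exact_scale)
  from exact_add[OF this exact_scale[OF exact_reversal[OF cocycle_weighted_cup[OF g h]], of "-1"]]
  show ?thesis
    by (rule exact_cong) (simp add: reversal_weighted_cup right_diff_distrib)
qed


section \<open>Cohomology classes\<close>

definition evaluate :: "('a \<Rightarrow> int) \<Rightarrow> ('a \<Rightarrow>\<^sub>0 int) \<Rightarrow> int" where
  "evaluate g c = (\<Sum>s\<in>Poly_Mapping.keys c. Poly_Mapping.lookup c s * g s)"

text \<open>Supports can shrink through cancellation or a zero coefficient, so linearity is checked
  on a common larger index set.\<close>

lemma evaluate_superset:
  assumes "finite S" "Poly_Mapping.keys c \<subseteq> S"
  shows "evaluate g c = (\<Sum>s\<in>S. Poly_Mapping.lookup c s * g s)"
  unfolding evaluate_def using assms by (intro sum.mono_neutral_left) (auto simp: in_keys_iff)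

lemma evaluate_0 [simp]: "evaluate g 0 = 0"
  by (simp add: evaluate_def)

lemma evaluate_frag_of [simp]: "evaluate g (frag_of s) = g s"
  by (simp add: evaluate_def)

lemma evaluate_add: "evaluate g (a + b) = evaluate g a + evaluate g b"
proof -
  let ?S = "Poly_Mapping.keys a \<union> Poly_Mapping.keys b"
  have S: "finite ?S" "Poly_Mapping.keys (a + b) \<subseteq> ?S"
    using keys_add[of a b] by simp_all
  show ?thesis
    unfolding evaluate_superset[OF S] evaluate_superset[of ?S a, OF S(1) Un_upper1]
      evaluate_superset[of ?S b, OF S(1) Un_upper2]
    by (simp add: lookup_add distrib_right sum.distrib)
qed

lemma evaluate_cmul: "evaluate g (frag_cmul k c) = k * evaluate g c"
proof -
  have "evaluate g (frag_cmul k c) = (\<Sum>s\<in>Poly_Mapping.keys c. Poly_Mapping.lookup (frag_cmul k c) s * g s)"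
    by (rule evaluate_superset[OF finite_keys keys_cmul])
  then show ?thesis
    by (simp add: evaluate_def sum_distrib_left mult.assoc)
qed

lemma evaluate_sum: "evaluate g (sum f A) = (\<Sum>a\<in>A. evaluate g (f a))"
  by (induction A rule: infinite_finite_induct) (auto simp: evaluate_add)

lemma evaluate_frag_extend: "evaluate g (frag_extend f c) = evaluate (\<lambda>s. evaluate g (f s)) c"
  by (simp add: frag_extend_def evaluate_sum evaluate_cmul) (simp add: evaluate_def)

lemma evaluate_cong:
  assumes "\<And>s. s \<in> Poly_Mapping.keys c \<Longrightarrow> g s = h s"
  shows "evaluate g c = evaluate h c"
  using assms by (simp add: evaluate_def)

lemma evaluate_plus: "evaluate (\<lambda>s. g s + h s) c = evaluate g c + evaluate h c"
  by (simp add: evaluate_def distrib_left sum.distrib)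

section \<open>Dictionary between cochains and functions on generators\<close>

definition cochain_of :: "nat \<Rightarrow> 'a topology \<Rightarrow> ('a \<Rightarrow> nat) \<Rightarrow> ('a wsimplex \<Rightarrow> int) \<Rightarrow> ('a wsimplex \<Rightarrow>\<^sub>0 int) \<Rightarrow> int" where
  "cochain_of n X lam g = restrict (evaluate g) (carrier (wchain_group n X lam))"

lemma carrier_wchain_group: "c \<in> carrier (wchain_group n X lam) \<longleftrightarrow> Poly_Mapping.keys c \<subseteq> wsimplex n X lam"
  by (simp add: wchain_group_def)

lemma cochain_of_eq_iff:
  "cochain_of n X lam g = cochain_of n X lam h \<longleftrightarrow> (\<forall>s\<in>wsimplex n X lam. g s = h s)"
proof
  assume eq: "cochain_of n X lam g = cochain_of n X lam h"
  show "\<forall>s\<in>wsimplex n X lam. g s = h s"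
  proof
    fix s assume "s \<in> wsimplex n X lam"
    then show "g s = h s"
      using fun_cong[OF eq, of "frag_of s"] by (simp add: cochain_of_def carrier_wchain_group)
  qed
next
  assume "\<forall>s\<in>wsimplex n X lam. g s = h s"
  then show "cochain_of n X lam g = cochain_of n X lam h"
    unfolding cochain_of_def by (intro restrict_ext evaluate_cong) (auto simp: carrier_wchain_group)
qed

text \<open>The universal property of the free abelian group: a homomorphism is the linear extension
  of its values on generators.\<close>

lemma carrier_wcochain_group: "carrier (wcochain_group n X lam) = range (cochain_of n X lam)"
proof (intro equalityI subsetI)
  fix \<phi> assume "\<phi> \<in> carrier (wcochain_group n X lam)"
  then have hom: "\<phi> \<in> hom (wchain_group n X lam) integer_group"
    and ext: "\<phi> \<in> extensional (carrier (wchain_group n X lam))"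
    by (simp_all add: wcochain_group_def)
  interpret group_hom "wchain_group n X lam" integer_group \<phi>
    using hom by (simp add: group_hom_def group_hom_axioms_def wchain_group_def)
  have add: "\<phi> (a + b) = \<phi> a + \<phi> b"
    if "Poly_Mapping.keys a \<subseteq> wsimplex n X lam" "Poly_Mapping.keys b \<subseteq> wsimplex n X lam" for a b
    using that hom_mult[of a b] by (simp add: wchain_group_def)
  let ?\<epsilon> = "evaluate (\<lambda>s. \<phi> (frag_of s))"
  have "\<phi> c = ?\<epsilon> c" if "Poly_Mapping.keys c \<subseteq> wsimplex n X lam" for c
  proof (rule free_Abelian_group_induct[OF that])
    show "\<phi> 0 = ?\<epsilon> 0"
      using hom_one by (simp add: wchain_group_def)
    fix a b
    assume keys: "Poly_Mapping.keys a \<subseteq> wsimplex n X lam" "Poly_Mapping.keys b \<subseteq> wsimplex n X lam"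
      and eq: "\<phi> a = ?\<epsilon> a" "\<phi> b = ?\<epsilon> b"
    \<comment> \<open>The induction closes under differences while additivity concerns sums, so it
      is applied to \<open>a - b\<close> and \<open>b\<close>.\<close>
    have "Poly_Mapping.keys (a - b) \<subseteq> wsimplex n X lam"
      using keys keys_diff[of a b] by blast
    then have "\<phi> (a - b) + \<phi> b = ?\<epsilon> (a - b) + ?\<epsilon> b"
      using add[of "a - b" b] evaluate_add[of _ "a - b" b] keys eq by simp
    then show "\<phi> (a - b) = ?\<epsilon> (a - b)"
      using eq by simp
  qed simp
  then have "\<phi> = cochain_of n X lam (\<lambda>s. \<phi> (frag_of s))"
    using ext unfolding cochain_of_def
    by (intro extensionalityI[of \<phi> "carrier (wchain_group n X lam)"]) (auto simp: carrier_wchain_group)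
  then show "\<phi> \<in> range (cochain_of n X lam)"
    by blast
next
  fix \<phi> assume "\<phi> \<in> range (cochain_of n X lam)"
  then obtain g where \<phi>: "\<phi> = cochain_of n X lam g" by blast
  have "Poly_Mapping.keys (a + b) \<subseteq> wsimplex n X lam"
    if "Poly_Mapping.keys a \<subseteq> wsimplex n X lam" "Poly_Mapping.keys b \<subseteq> wsimplex n X lam"
    for a b :: "'a wsimplex \<Rightarrow>\<^sub>0 int"
    using that keys_add[of a b] by blast
  then have "\<phi> \<in> hom (wchain_group n X lam) integer_group"
    by (intro homI) (simp_all add: \<phi> cochain_of_def evaluate_add wchain_group_def)
  then show "\<phi> \<in> carrier (wcochain_group n X lam)"
    by (simp add: wcochain_group_def \<phi> cochain_of_def)
qed

lemma mult_cochain_of: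
  "cochain_of n X lam g \<otimes>\<^bsub>wcochain_group n X lam\<^esub> cochain_of n X lam h = cochain_of n X lam (\<lambda>s. g s + h s)"
  by (auto simp: wcochain_group_def cochain_of_def evaluate_plus intro!: restrict_ext)

lemma one_wcochain_group: "\<one>\<^bsub>wcochain_group n X lam\<^esub> = cochain_of n X lam (\<lambda>s. 0)"
  by (auto simp: wcochain_group_def cochain_of_def evaluate_def intro!: restrict_ext)

text \<open>A cochain is unspecified off the chain group, so composing it with the boundary requires
  this.\<close>

lemma wboundary_in_wchain_group:
  assumes "c \<in> carrier (wchain_group (Suc n) X lam)"
  shows "wboundary (Suc n) c \<in> carrier (wchain_group n X lam)"
  unfolding wboundary_def frag_extend_def wchain_group_def
proof (simp only: nat.simps if_False, intro sum_closed_free_Abelian_group)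
  fix s assume "s \<in> Poly_Mapping.keys c"
  then have s: "s \<in> wsimplex (Suc n) X lam"
    using assms by (auto simp: carrier_wchain_group)
  let ?f = "\<lambda>j. frag_cmul ((-1) ^ j * int (snd s ({..Suc n} - {j}) div snd s {..Suc n}))
      (frag_of (wface (Suc n - 1) (skip j) s))"
  have "sum ?f {..Suc n} \<in> carrier (free_Abelian_group (wsimplex n X lam))"
  proof (intro sum_closed_free_Abelian_group)
    fix j
    have "wface (Suc n - 1) (skip j) s \<in> wsimplex n X lam"
      using wface_in_wsimplex[OF s skip_image_subset] by simp
    then show "?f j \<in> carrier (free_Abelian_group (wsimplex n X lam))"
      unfolding carrier_free_Abelian_group_iff by (intro order_trans[OF keys_cmul]) simp
  qed
  then show "frag_cmul (Poly_Mapping.lookup c s) (sum ?f {..Suc n})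
      \<in> carrier (free_Abelian_group (wsimplex n X lam))"
    unfolding carrier_free_Abelian_group_iff by (rule order_trans[OF keys_cmul])
qed

lemma wcoboundary_cochain_of: "wcoboundary n X lam (cochain_of n X lam g) = cochain_of (Suc n) X lam (wcodiff n g)"
proof -
  have "evaluate g (wboundary (Suc n) c) = evaluate (wcodiff n g) c" for c :: "'a wsimplex \<Rightarrow>\<^sub>0 int"
    unfolding wboundary_def
    by (simp add: evaluate_frag_extend evaluate_sum evaluate_cmul wcodiff_def[abs_def] del: sum.atMost_Suc)
  then show ?thesis
    unfolding wcoboundary_def cochain_of_def
    by (intro restrict_ext) (simp add: wboundary_in_wchain_group)
qed

lemma wcocycles_eq: "wcocycles n X lam = cochain_of n X lam ` {g. cocycle n X lam g}"
proof -
  have "wcoboundary n X lam (cochain_of n X lam g) = \<one>\<^bsub>wcochain_group (Suc n) X lam\<^esub> \<longleftrightarrow> cocycle n X lam g" for g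
    by (simp add: wcoboundary_cochain_of one_wcochain_group cochain_of_eq_iff cocycle_def)
  then show ?thesis
    unfolding wcocycles_def kernel_def carrier_wcochain_group by blast
qed

lemma wcoboundaries_eq: "wcoboundaries n X lam = cochain_of n X lam ` {g. exact n X lam g}"
proof (cases n)
  case 0
  have "cochain_of 0 X lam g = cochain_of 0 X lam (\<lambda>s. 0)" if "exact 0 X lam g" for g
    using that by (simp add: cochain_of_eq_iff exact_def)
  moreover have "exact 0 X lam (\<lambda>s. 0)"
    by (rule exactI_zero) simp
  ultimately show ?thesis
    unfolding 0 wcoboundaries_def one_wcochain_group nat.case by blast
next
  case (Suc m)
  have "cochain_of (Suc m) X lam g \<in> range (\<lambda>h. cochain_of (Suc m) X lam (wcodiff m h))"
    if g: "exact (Suc m) X lam g" for g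
  proof -
    obtain h where "\<And>s. s \<in> wsimplex (Suc m) X lam \<Longrightarrow> g s = wcodiff m h s"
      using g by (rule exactE) (rule that)
    then have "cochain_of (Suc m) X lam g = cochain_of (Suc m) X lam (wcodiff m h)"
      by (simp add: cochain_of_eq_iff)
    then show ?thesis by blast
  qed
  moreover have "exact (Suc m) X lam (wcodiff m h)" for h
    by (rule exactI) simp
  ultimately show ?thesis
    unfolding Suc wcoboundaries_def carrier_wcochain_group nat.case image_image wcoboundary_cochain_of
    by blast
qed

section \<open>Cohomology groups and their classes\<close>

lemma carrier_wcocycle_group: "carrier (wcocycle_group n X lam) = cochain_of n X lam ` {g. cocycle n X lam g}"
  by (simp add: wcocycle_group_def wcocycles_eq)

lemma mult_wcocycle_group:
  "cochain_of n X lam g \<otimes>\<^bsub>wcocycle_group n X lam\<^esub> cochain_of n X lam h = cochain_of n X lam (\<lambda>s. g s + h s)"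
  by (simp add: wcocycle_group_def mult_cochain_of)

lemma one_wcocycle_group: "\<one>\<^bsub>wcocycle_group n X lam\<^esub> = cochain_of n X lam (\<lambda>s. 0)"
  by (simp add: wcocycle_group_def one_wcochain_group)

lemma comm_group_wcocycle_group: "comm_group (wcocycle_group n X lam)"
proof (rule comm_groupI)
  have zero: "cocycle n X lam (\<lambda>s. 0)"
    by (rule cocycle_if_exact, rule exactI_zero) simp
  then show "\<one>\<^bsub>wcocycle_group n X lam\<^esub> \<in> carrier (wcocycle_group n X lam)"
    by (simp add: carrier_wcocycle_group one_wcocycle_group)
  fix x assume "x \<in> carrier (wcocycle_group n X lam)"
  then obtain g where x: "x = cochain_of n X lam g" and g: "cocycle n X lam g"
    by (auto simp: carrier_wcocycle_group)
  show "\<one>\<^bsub>wcocycle_group n X lam\<^esub> \<otimes>\<^bsub>wcocycle_group n X lam\<^esub> x = x"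
    by (simp add: x one_wcocycle_group mult_wcocycle_group)
  show "\<exists>y\<in>carrier (wcocycle_group n X lam). y \<otimes>\<^bsub>wcocycle_group n X lam\<^esub> x = \<one>\<^bsub>wcocycle_group n X lam\<^esub>"
    using cocycle_scale[OF g, of "-1"]
    by (intro bexI[of _ "cochain_of n X lam (\<lambda>s. -1 * g s)"])
      (simp_all add: x one_wcocycle_group mult_wcocycle_group carrier_wcocycle_group)
  fix y assume "y \<in> carrier (wcocycle_group n X lam)"
  then obtain h where y: "y = cochain_of n X lam h" and h: "cocycle n X lam h"
    by (auto simp: carrier_wcocycle_group)
  show "x \<otimes>\<^bsub>wcocycle_group n X lam\<^esub> y \<in> carrier (wcocycle_group n X lam)"
    using cocycle_add[OF g h] by (simp add: x y mult_wcocycle_group carrier_wcocycle_group)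
  show "x \<otimes>\<^bsub>wcocycle_group n X lam\<^esub> y = y \<otimes>\<^bsub>wcocycle_group n X lam\<^esub> x"
    by (simp add: x y mult_wcocycle_group add.commute)
  fix z assume "z \<in> carrier (wcocycle_group n X lam)"
  then obtain k where z: "z = cochain_of n X lam k"
    by (auto simp: carrier_wcocycle_group)
  show "x \<otimes>\<^bsub>wcocycle_group n X lam\<^esub> y \<otimes>\<^bsub>wcocycle_group n X lam\<^esub> z
      = x \<otimes>\<^bsub>wcocycle_group n X lam\<^esub> (y \<otimes>\<^bsub>wcocycle_group n X lam\<^esub> z)"
    by (simp add: x y z mult_wcocycle_group add.assoc)
qed

lemma normal_wcoboundaries: "wcoboundaries n X lam \<lhd> wcocycle_group n X lam"
proof -
  interpret comm_group "wcocycle_group n X lam"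
    by (rule comm_group_wcocycle_group)
  show ?thesis
  proof (intro subgroup_imp_normal subgroupI)
    show "wcoboundaries n X lam \<subseteq> carrier (wcocycle_group n X lam)"
      by (auto simp: wcoboundaries_eq carrier_wcocycle_group cocycle_if_exact)
    have "exact n X lam (\<lambda>s. 0)"
      by (rule exactI_zero) simp
    then show "wcoboundaries n X lam \<noteq> {}"
      by (auto simp: wcoboundaries_eq)
    fix x assume "x \<in> wcoboundaries n X lam"
    then obtain g where x: "x = cochain_of n X lam g" and g: "exact n X lam g"
      by (auto simp: wcoboundaries_eq)
    have "inv\<^bsub>wcocycle_group n X lam\<^esub> x = cochain_of n X lam (\<lambda>s. -1 * g s)"
      using cocycle_if_exact[OF g] cocycle_scale[OF cocycle_if_exact[OF g], of "-1"]
      by (intro inv_equality) (simp_all add: x mult_wcocycle_group one_wcocycle_group carrier_wcocycle_group)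
    then show "inv\<^bsub>wcocycle_group n X lam\<^esub> x \<in> wcoboundaries n X lam"
      using exact_scale[OF g, of "-1"] by (simp add: wcoboundaries_eq)
    fix y assume "y \<in> wcoboundaries n X lam"
    then obtain h where y: "y = cochain_of n X lam h" and h: "exact n X lam h"
      by (auto simp: wcoboundaries_eq)
    show "x \<otimes>\<^bsub>wcocycle_group n X lam\<^esub> y \<in> wcoboundaries n X lam"
      using exact_add[OF g h] by (simp add: x y mult_wcocycle_group wcoboundaries_eq)
  qed
qed

lemma wclass_cochain_of:
  "wclass n X lam (cochain_of n X lam g) = cochain_of n X lam ` {h. exact n X lam (\<lambda>s. h s - g s)}"
proof (intro equalityI subsetI)
  fix \<phi> assume "\<phi> \<in> wclass n X lam (cochain_of n X lam g)"
  then obtain k where "exact n X lam k" "\<phi> = cochain_of n X lam (\<lambda>s. k s + g s)"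
    by (auto simp: wclass_def r_coset_def wcoboundaries_eq mult_wcocycle_group)
  then show "\<phi> \<in> cochain_of n X lam ` {h. exact n X lam (\<lambda>s. h s - g s)}"
    by (intro image_eqI[of _ _ "\<lambda>s. k s + g s"]) simp_all
next
  fix \<phi> assume "\<phi> \<in> cochain_of n X lam ` {h. exact n X lam (\<lambda>s. h s - g s)}"
  then obtain h where h: "exact n X lam (\<lambda>s. h s - g s)" and \<phi>: "\<phi> = cochain_of n X lam h"
    by blast
  have "cochain_of n X lam (\<lambda>s. h s - g s) \<otimes>\<^bsub>wcocycle_group n X lam\<^esub> cochain_of n X lam g = \<phi>"
    by (simp add: mult_wcocycle_group \<phi>)
  then show "\<phi> \<in> wclass n X lam (cochain_of n X lam g)"
    using h unfolding wclass_def r_coset_def wcoboundaries_eq by blast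
qed

lemma wclass_cochain_of_eqI:
  assumes "exact n X lam (\<lambda>s. g s - h s)"
  shows "wclass n X lam (cochain_of n X lam g) = wclass n X lam (cochain_of n X lam h)"
proof -
  have "exact n X lam (\<lambda>s. k s - g s) \<longleftrightarrow> exact n X lam (\<lambda>s. k s - h s)" for k
    using exact_add[OF _ assms, of "\<lambda>s. k s - g s"]
      exact_add[OF _ exact_scale[OF assms, of "-1"], of "\<lambda>s. k s - h s"]
    by (auto simp: algebra_simps)
  then show ?thesis
    by (simp add: wclass_cochain_of)
qed

lemma wcup_cochain_of:
  "wcup p q X lam (cochain_of p X lam g) (cochain_of q X lam h) = cochain_of (p + q) X lam (weighted_cup p q g h)"
  unfolding wcup_def cochain_of_def[of "p + q"]
proof (rule restrict_ext)
  fix c assume "c \<in> carrier (wchain_group (p + q) X lam)"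
  then have c: "s \<in> wsimplex (p + q) X lam" if "s \<in> Poly_Mapping.keys c" for s
    using that by (auto simp: carrier_wchain_group)
  have "cochain_of p X lam g (frag_of (wface p (\<lambda>i. i) s)) = g (wface p (\<lambda>i. i) s)"
    "cochain_of q X lam h (frag_of (wface q ((+) p) s)) = h (wface q ((+) p) s)"
    if "s \<in> Poly_Mapping.keys c" for s
    using front_face_in_wsimplex[OF c[OF that]] back_face_in_wsimplex[OF c[OF that]]
    by (simp_all add: cochain_of_def carrier_wchain_group)
  then show "(\<Sum>s\<in>Poly_Mapping.keys c. Poly_Mapping.lookup c s *
      (int (snd s {..p} * snd s {p..p + q} div snd s {..p + q}) *
       cochain_of p X lam g (frag_of (wface p (\<lambda>i. i) s)) * cochain_of q X lam h (frag_of (wface q (\<lambda>i. p + i) s))))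
    = evaluate (weighted_cup p q g h) c"
    unfolding evaluate_def weighted_cup_def by (intro sum.cong) simp_all
qed

lemma wcup_class_cochain_of:
  assumes g: "cocycle p X lam g" and h: "cocycle q X lam h"
  shows "wcup_class p q X lam (wclass p X lam (cochain_of p X lam g)) (wclass q X lam (cochain_of q X lam h))
    = wclass (p + q) X lam (cochain_of (p + q) X lam (weighted_cup p q g h))" (is "_ = ?C")
proof -
  have const: "wclass (p + q) X lam (wcup p q X lam \<phi> \<psi>) = ?C"
    if \<phi>: "\<phi> \<in> wclass p X lam (cochain_of p X lam g)" and \<psi>: "\<psi> \<in> wclass q X lam (cochain_of q X lam h)" for \<phi> \<psi>
  proof -
    obtain g' h' where "\<phi> = cochain_of p X lam g'" "exact p X lam (\<lambda>s. g' s - g s)"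
      "\<psi> = cochain_of q X lam h'" "exact q X lam (\<lambda>s. h' s - h s)"
      using \<phi> \<psi> unfolding wclass_cochain_of by blast
    then show ?thesis
      using weighted_cup_cohomologous[OF g h] by (simp add: wcup_cochain_of wclass_cochain_of_eqI)
  qed
  \<comment> \<open>Constancy alone leaves open that the union is empty; each class contains its own
    representative.\<close>
  have "exact n X lam (\<lambda>s. k s - k s)" for n and k :: "'a wsimplex \<Rightarrow> int"
    by (rule exactI_zero) simp
  then have "cochain_of p X lam g \<in> wclass p X lam (cochain_of p X lam g)"
    "cochain_of q X lam h \<in> wclass q X lam (cochain_of q X lam h)"
    unfolding wclass_cochain_of by blast+
  then show ?thesis
    unfolding wcup_class_def using const by blast
qed

theorem theorem5p6:
  fixes X :: "'a topology" and lam :: "'a \<Rightarrow> nat" and p q :: nat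
    and \<phi> \<psi> :: "('a wsimplex \<Rightarrow>\<^sub>0 int) \<Rightarrow> int"
  assumes "descending_weighted_polyhedron TYPE('b::euclidean_space) X lam"
    and "\<phi> \<in> wcocycles p X lam" and "\<psi> \<in> wcocycles q X lam"
  shows "wcup_class p q X lam (wclass p X lam \<phi>) (wclass q X lam \<psi>) =
    wcup_class q p X lam (wclass q X lam \<psi>) (wclass p X lam \<phi>)
      [^]\<^bsub>wcohomology_group (p + q) X lam\<^esub> ((-1) ^ (p * q) :: int)"
proof -
  obtain g h where g: "cocycle p X lam g" "\<phi> = cochain_of p X lam g" and h: "cocycle q X lam h" "\<psi> = cochain_of q X lam h"
    using assms(2,3) by (auto simp: wcocycles_eq)
  define a b where "a = cochain_of (p + q) X lam (weighted_cup p q g h)"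
    and "b = cochain_of (p + q) X lam (weighted_cup q p h g)"
  let ?Z = "wcocycle_group (p + q) X lam" and ?B = "wcoboundaries (p + q) X lam"
  let ?H = "wcohomology_group (p + q) X lam"
  interpret normal ?B ?Z
    by (rule normal_wcoboundaries)
  interpret H: group ?H
    unfolding wcohomology_group_def by (rule factorgroup_is_group)
  have ab: "a \<in> carrier ?Z" "b \<in> carrier ?Z"
    using cocycle_weighted_cup[OF g(1) h(1)] cocycle_weighted_cup[OF h(1) g(1)]
    by (auto simp: a_def b_def carrier_wcocycle_group add.commute)
  have classes: "wclass (p + q) X lam c \<in> carrier ?H" if "c \<in> carrier ?Z" for c
    using that by (simp add: wclass_def wcohomology_group_def carrier_FactGroup)
  have comm: "exact (p + q) X lam (\<lambda>s. weighted_cup p q g h s - (-1) ^ (p * q) * weighted_cup q p h g s)"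
    using g(1) h(1) by (rule weighted_cup_graded_commutative)
  \<comment> \<open>The cohomology group is written multiplicatively, so the sign is an exponent:
    the power 1 or the inverse.\<close>
  have "wclass (p + q) X lam a = wclass (p + q) X lam b [^]\<^bsub>?H\<^esub> ((-1) ^ (p * q) :: int)"
  proof (cases "even (p * q)")
    case True
    then have "wclass (p + q) X lam a = wclass (p + q) X lam b"
      using comm unfolding a_def b_def by (intro wclass_cochain_of_eqI) simp
    then show ?thesis
      using True classes[OF ab(2)] by simp
  next
    case False
    \<comment> \<open>For an odd sign the difference in \<open>comm\<close> becomes a sum, so the
      two classes multiply to the identity and are inverse to each other.\<close>
    then have "a \<otimes>\<^bsub>?Z\<^esub> b \<in> ?B"
      using comm by (simp add: a_def b_def mult_wcocycle_group wcoboundaries_eq)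
    then have "wclass (p + q) X lam a \<otimes>\<^bsub>?H\<^esub> wclass (p + q) X lam b = \<one>\<^bsub>?H\<^esub>"
      using ab by (simp add: wclass_def wcohomology_group_def rcos_sum rcos_const[OF is_group])
    then have "inv\<^bsub>?H\<^esub> wclass (p + q) X lam b = wclass (p + q) X lam a"
      using classes ab by (intro H.inv_equality) auto
    then show ?thesis
      using False classes[OF ab(2)] H.int_pow_neg[of "wclass (p + q) X lam b" 1] by simp
  qed
  moreover have "wcup_class p q X lam (wclass p X lam \<phi>) (wclass q X lam \<psi>) = wclass (p + q) X lam a"
    unfolding g(2) h(2) a_def by (rule wcup_class_cochain_of[OF g(1) h(1)])
  moreover have "wcup_class q p X lam (wclass q X lam \<psi>) (wclass p X lam \<phi>) = wclass (p + q) X lam b"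
    using wcup_class_cochain_of[OF h(1) g(1)] unfolding g(2) h(2) b_def by (simp add: add.commute)
  ultimately show ?thesis
    by simp
qed

end
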